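(* Let $n=2$, let $q$ be a prime power and $\mathbb{V}_0=\mathbb{F}_q^2$. Let $\mathcal{T}_1$ be the set of all twin classes of $\mathbf{SIG}(\mathbb{V}_0)$ in the part $\mathcal{E}^1(\mathbb{F}_q)$ whose vertices have exactly one eigendirection, with $|\mathcal{T}_1|=q+1$, and let $\mathcal{T}_2$ be the set of all twin classes in the part $\mathcal{E}^1(\mathbb{F}_q)$ whose vertices have exactly two distinct eigendirections, with $|\mathcal{T}_2|=\frac{q(q+1)}{2}$. Then there exists a split short exact sequence $$1\longrightarrow \Big(\prod_{\mathcal{C}\in\mathcal{T}_1}S_{\mathcal{C}}\times\prod_{\mathcal{C}\in\mathcal{T}_2}S_{\mathcal{C}}\Big)\overset{i}{\longrightarrow}Aut(\mathbf{SIG}(\mathbb{V}_0))\overset{\Phi}{\longrightarrow}S_{\mathbb{P}^1(\mathbb{F}_q)}\longrightarrow 1 .$$ Consequently, $$Aut(\mathbf{SIG}(\mathbb{V}_0))\cong\Big(\prod_{\mathcal{C}\in\mathcal{T}_1}S_q\times\prod_{\mathcal{C}\in\mathcal{T}_2}S_q\Big)\rtimes_\theta S_{q+1}=\Big(\prod_{i=1}^{q+1}S_q\times\prod_{i=1}^{\frac{q(q+1)}{2}}S_q\Big)\rtimes_\theta S_{q+1},$$ where the action $\theta:S_{q+1}\cong S_{\mathbb{P}^1(\mathbb{F}_q)}\to Aut\big(\prod_{\mathcal{C}\in\mathcal{T}_1}S_q\times\prod_{\mathcal{C}\in\mathcal{T}_2}S_q\big)$ defining the semidirect product is given by conjugation,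 $\theta(\sigma)(\kappa)=\widehat{\sigma}\,\kappa\,\widehat{\sigma}^{-1}$, with $\widehat{\sigma}$ the extension of $\sigma$ to a graph automorphism of $\mathbf{SIG}(\mathbb{V}_0)$ described in the context.
   Context: $\mathbb{F}_q$ is the finite field with $q$ elements and $\mathbb{V}_0=\mathbb{F}_q^2$ is the space of column vectors. $E_2(\mathbb{F}_q)$ is the set of nonzero matrices $M\in M_2(\mathbb{F}_q)$ having at least one eigenvector in $\mathbb{V}_0$ (a nonzero $v$ with $Mv=\lambda v$ for some $\lambda\in\mathbb{F}_q$; $\lambda=0$ allowed). $\mathcal{E}^{1}(\mathbb{F}_q)=\{\langle M\rangle: M\in E_2(\mathbb{F}_q)\}$ is the set of one-dimensional subspaces of $M_2(\mathbb{F}_q)$ generated by elements of $E_2(\mathbb{F}_q)$, and $\mathbb{P}^{1}(\mathbb{F}_q)$ is the set of one-dimensional subspaces $\langle v\rangle$ of $\mathbb{V}_0$. The spectral incidence graph $\mathbf{SIG}(\mathbb{V}_0)$ is the simple bipartite graph with vertex set the disjoint union $\mathcal{E}^{1}(\mathbb{F}_q)\cup\mathbb{P}^{1}(\mathbb{F}_q)$ in which $\langle M\rangle$ and $\langle v\rangle$ are adjacent iff $v$ is an eigenvector of $M$. The neighbours of $\langle M\rangle$ are called its eigendirections. $N(x)$ is the set of neighbours of $x$; two vertices $x,y$ are twins if $N(x)=N(y)$, and the twin classes are the equivalence classes of this relation. $Aut$ of a graph is its group of graph automorphisms (permutations of the whole vertex set preserving adjacency in both directions). $S_X$ is the symmetric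 group on a set $X$ and $S_m$ the symmetric group on $\{1,\dots,m\}$. The product $\prod_{\mathcal{C}\in\mathcal{T}_1}S_{\mathcal{C}}\times\prod_{\mathcal{C}\in\mathcal{T}_2}S_{\mathcal{C}}$ is viewed inside $Aut(\mathbf{SIG}(\mathbb{V}_0))$ by letting each element permute every twin class in $\mathcal{T}_1\cup\mathcal{T}_2$ by the corresponding component and fix all other vertices; $i$ is this inclusion. $\Phi$ is the restriction map $\Phi(\varphi)=\varphi|_{\mathbb{P}^1(\mathbb{F}_q)}$. A short exact sequence $1\to K\to G\overset{\Phi}{\to}H\to1$ splits if there is a homomorphism $\Psi:H\to G$ with $\Phi\circ\Psi=id_H$. Extension $\widehat{\sigma}$: for every $X\subseteq\mathbb{P}^1(\mathbb{F}_q)$ with $1\le|X|\le2$ let $A_X=\{\langle M\rangle\in\mathcal{E}^1(\mathbb{F}_q):N(\langle M\rangle)=X\}$, which has exactly $q$ elements, and fix a labeling $A_X=\{\langle M_{X,1}\rangle,\dots,\langle M_{X,q}\rangle\}$. For $\sigma\in S_{\mathbb{P}^1(\mathbb{F}_q)}$, $\widehat{\sigma}$ is defined by $\widehat{\sigma}(\langle v\rangle)=\sigma(\langle v\rangle)$ for all $\langle v\rangle\in\mathbb{P}^1(\mathbb{F}_q)$, $\widehat{\sigma}(\langle M_{X,i}\rangle)=\langle M_{\sigma(X),i}\rangle$ for all such $X$ and $1\le i\le q$, and $\widehat{\sigma}(\langle I_2\rangle)=\langle I_2\rangle$. *)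

theory Defs
  imports
    "HOL-Analysis.Cartesian_Space"
    "HOL-Algebra.Bij"
    "HOL-Algebra.Product_Groups"
    "HOL-Algebra.Sym_Groups"
begin

section \<open>Group theory\<close>

text \<open>
  The library's \<open>short_exact_sequence\<close> needs all groups to live on one type, which is not the
  case here.
\<close>

definition short_exact ::
  "('k, 'x) monoid_scheme \<Rightarrow> ('g, 'y) monoid_scheme \<Rightarrow> ('h, 'z) monoid_scheme
    \<Rightarrow> ('k \<Rightarrow> 'g) \<Rightarrow> ('g \<Rightarrow> 'h) \<Rightarrow> bool"
where
  "short_exact K G H i p \<longleftrightarrow>
     group K \<and> group G \<and> group H \<and>
     i \<in> mon K G \<and> i ` carrier K = kernel G H p \<and> p \<in> epi G H"

definition splits ::
  "('g, 'y) monoid_scheme \<Rightarrow> ('h, 'z) monoid_scheme \<Rightarrow> ('g \<Rightarrow> 'h) \<Rightarrow> bool"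
where
  "splits G H p \<longleftrightarrow> (\<exists>s \<in> hom H G. \<forall>h \<in> carrier H. p (s h) = h)"

definition semidirect ::
  "('k, 'x) monoid_scheme \<Rightarrow> ('h \<Rightarrow> 'k \<Rightarrow> 'k) \<Rightarrow> ('h, 'z) monoid_scheme \<Rightarrow> ('k \<times> 'h) monoid"
where
  "semidirect K \<theta> H =
     \<lparr>carrier = carrier K \<times> carrier H,
      monoid.mult = (\<lambda>(k, h) (k', h'). (k \<otimes>\<^bsub>K\<^esub> \<theta> h k', h \<otimes>\<^bsub>H\<^esub> h')),
      one = (\<one>\<^bsub>K\<^esub>, \<one>\<^bsub>H\<^esub>)\<rparr>"

text \<open>
  The action of \<open>H\<close> on \<open>K\<close> by conjugation inside \<open>G\<close>, where \<open>K\<close> is embedded into \<open>G\<close> by \<open>j\<close>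
  and \<open>s\<close> lifts elements of \<open>H\<close> to \<open>G\<close>.
\<close>

definition conj_action ::
  "('k, 'x) monoid_scheme \<Rightarrow> ('g, 'y) monoid_scheme \<Rightarrow> ('k \<Rightarrow> 'g) \<Rightarrow> ('h \<Rightarrow> 'g)
    \<Rightarrow> 'h \<Rightarrow> 'k \<Rightarrow> 'k"
where
  "conj_action K G j s h =
     (\<lambda>k \<in> carrier K. inv_into (carrier K) j (s h \<otimes>\<^bsub>G\<^esub> j k \<otimes>\<^bsub>G\<^esub> inv\<^bsub>G\<^esub> (s h)))"

text \<open>
  The permutation of \<open>S\<close> corresponding to a permutation \<open>p\<close> of \<open>{1..m}\<close> under a bijection
  \<open>b\<close> from \<open>{1..m}\<close> to \<open>S\<close>.
\<close>

definition perm_via :: "(nat \<Rightarrow> 'v) \<Rightarrow> nat \<Rightarrow> 'v set \<Rightarrow> (nat \<Rightarrow> nat) \<Rightarrow> 'v \<Rightarrow> 'v" where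
  "perm_via b m S p = (\<lambda>x \<in> S. b (p (inv_into {1..m} b x)))"


section \<open>Graphs\<close>

definition nbhd :: "'v set \<Rightarrow> ('v \<Rightarrow> 'v \<Rightarrow> bool) \<Rightarrow> 'v \<Rightarrow> 'v set" where
  "nbhd V E x = {y \<in> V. E x y}"

definition graph_aut :: "'v set \<Rightarrow> ('v \<Rightarrow> 'v \<Rightarrow> bool) \<Rightarrow> ('v \<Rightarrow> 'v) monoid" where
  "graph_aut V E =
     BijGroup V \<lparr>carrier := {f \<in> Bij V. \<forall>x \<in> V. \<forall>y \<in> V. E (f x) (f y) \<longleftrightarrow> E x y}\<rparr>"

definition twin_rel :: "'v set \<Rightarrow> ('v \<Rightarrow> 'v \<Rightarrow> bool) \<Rightarrow> ('v \<times> 'v) set" where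
  "twin_rel V E = {(x, y). x \<in> V \<and> y \<in> V \<and> nbhd V E x = nbhd V E y}"


section \<open>The spectral incidence graph of the plane over a finite field\<close>

definition eigenvector :: "'a::field^2^2 \<Rightarrow> 'a^2 \<Rightarrow> bool" where
  "eigenvector M v \<longleftrightarrow> v \<noteq> 0 \<and> (\<exists>c. M *v v = c *s v)"

definition E2 :: "('a::field^2^2) set" where
  "E2 = {M. M \<noteq> 0 \<and> (\<exists>v. eigenvector M v)}"

definition mat_scale :: "'a::field \<Rightarrow> 'a^2^2 \<Rightarrow> 'a^2^2" where
  "mat_scale c M = (\<chi> i. c *s (M $ i))"

definition mat_line :: "'a::field^2^2 \<Rightarrow> ('a^2^2) set" where
  "mat_line M = module.span mat_scale {M}"

definition vec_line :: "'a::field^2 \<Rightarrow> ('a^2) set" where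
  "vec_line v = vec.span {v}"

definition E_lines :: "('a::field^2^2) set set" where
  "E_lines = mat_line ` E2"

definition P_lines :: "('a::field^2) set set" where
  "P_lines = vec_line ` {v. v \<noteq> 0}"

type_synonym 'a vertex = "('a^2^2) set + ('a^2) set"

definition sig_verts :: "'a::field vertex set" where
  "sig_verts = E_lines <+> P_lines"

text \<open>The two parts of the bipartition, as subsets of the disjoint union.\<close>

definition ops :: "'a::field vertex set" where
  "ops = Inl ` E_lines"

definition points :: "'a::field vertex set" where
  "points = Inr ` P_lines"

definition sig_adj :: "'a::field vertex \<Rightarrow> 'a vertex \<Rightarrow> bool" where
  "sig_adj x y \<longleftrightarrow>
     (\<exists>M \<in> E2. \<exists>v. eigenvector M v \<and>
        (x = Inl (mat_line M) \<and> y = Inr (vec_line v) \<or>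
         x = Inr (vec_line v) \<and> y = Inl (mat_line M)))"

abbreviation sig_nbhd :: "'a::field vertex \<Rightarrow> 'a vertex set" where
  "sig_nbhd \<equiv> nbhd sig_verts sig_adj"

definition sig_aut :: "('a::field vertex \<Rightarrow> 'a vertex) monoid" where
  "sig_aut = graph_aut sig_verts sig_adj"

abbreviation sig_twins :: "('a::field vertex \<times> 'a vertex) set" where
  "sig_twins \<equiv> twin_rel sig_verts sig_adj"

text \<open>The twin classes consisting of operators with exactly \<open>k\<close> eigendirections.\<close>

definition op_twin_classes :: "nat \<Rightarrow> 'a::field vertex set set" where
  "op_twin_classes k =
     {C \<in> sig_verts // sig_twins. C \<subseteq> ops \<and> (\<forall>x \<in> C. card (sig_nbhd x) = k)}"

abbreviation T1 :: "'a::field vertex set set" where "T1 \<equiv> op_twin_classes 1"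
abbreviation T2 :: "'a::field vertex set set" where "T2 \<equiv> op_twin_classes 2"

type_synonym ('i, 'j, 'p) kernel_elt = "('i \<Rightarrow> 'p \<Rightarrow> 'p) \<times> ('j \<Rightarrow> 'p \<Rightarrow> 'p)"

definition twin_perms ::
  "('a::field vertex set, 'a vertex set, 'a vertex) kernel_elt monoid"
where
  "twin_perms = product_group T1 BijGroup \<times>\<times> product_group T2 BijGroup"

definition twin_incl ::
  "('a::field vertex set, 'a vertex set, 'a vertex) kernel_elt \<Rightarrow> 'a vertex \<Rightarrow> 'a vertex"
where
  "twin_incl = (\<lambda>(\<kappa>1, \<kappa>2). \<lambda>x \<in> sig_verts.
     let C = sig_twins `` {x} in
     if C \<in> T1 then \<kappa>1 C x else if C \<in> T2 then \<kappa>2 C x else x)"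

definition point_restr ::
  "('a::field vertex \<Rightarrow> 'a vertex) \<Rightarrow> 'a vertex \<Rightarrow> 'a vertex"
where
  "point_restr \<phi> = restrict \<phi> points"


section \<open>Labelings and the extension of a permutation of the points\<close>

definition ops_with :: "'a::field vertex set \<Rightarrow> 'a vertex set" where
  "ops_with X = {x \<in> ops. sig_nbhd x = X}"

definition labeling ::
  "('a::{field,finite} vertex set \<Rightarrow> nat \<Rightarrow> 'a vertex) \<Rightarrow> bool"
where
  "labeling lab \<longleftrightarrow>
     (\<forall>X \<subseteq> points. 1 \<le> card X \<and> card X \<le> 2 \<longrightarrow> bij_betw (lab X) {1..CARD('a)} (ops_with X))"

text \<open>
  A vertex of \<open>ops\<close> other than the identity line has the form \<open>lab X i\<close> where \<open>X\<close> is its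
  neighbourhood, and \<open>i\<close> is recovered by inverting \<open>lab X\<close>.
\<close>

definition hat ::
  "('a::{field,finite} vertex set \<Rightarrow> nat \<Rightarrow> 'a vertex) \<Rightarrow> ('a vertex \<Rightarrow> 'a vertex)
    \<Rightarrow> 'a vertex \<Rightarrow> 'a vertex"
where
  "hat lab \<sigma> = (\<lambda>x \<in> sig_verts.
     if x \<in> points then \<sigma> x
     else if x = Inl (mat_line (mat 1)) then x
     else let X = sig_nbhd x in lab (\<sigma> ` X) (inv_into {1..CARD('a)} (lab X) x))"


section \<open>Kernels built from copies of the symmetric group on \<open>q\<close> letters\<close>

definition sym_powers ::
  "'i set \<Rightarrow> 'j set \<Rightarrow> nat \<Rightarrow> ('i, 'j, nat) kernel_elt monoid"
where
  "sym_powers I J q =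
     product_group I (\<lambda>_. sym_group q) \<times>\<times> product_group J (\<lambda>_. sym_group q)"

text \<open>
  Each class \<open>C\<close> is identified with \<open>{1..q}\<close> by the labeling of \<open>ops_with X\<close>, where \<open>X\<close> is the
  common neighbourhood of the elements of \<open>C\<close>; the union below is over equal sets.
\<close>

definition relabel ::
  "('a::{field,finite} vertex set \<Rightarrow> nat \<Rightarrow> 'a vertex)
    \<Rightarrow> ('a vertex set, 'a vertex set, nat) kernel_elt
    \<Rightarrow> ('a vertex set, 'a vertex set, 'a vertex) kernel_elt"
where
  "relabel lab = (\<lambda>(\<kappa>1, \<kappa>2).
     (\<lambda>C \<in> T1. perm_via (lab (\<Union>x \<in> C. sig_nbhd x)) CARD('a) C (\<kappa>1 C),
      \<lambda>C \<in> T2. perm_via (lab (\<Union>x \<in> C. sig_nbhd x)) CARD('a) C (\<kappa>2 C)))"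

definition reindex ::
  "'i set \<Rightarrow> 'j set \<Rightarrow> ('i \<Rightarrow> 'c) \<Rightarrow> ('j \<Rightarrow> 'd) \<Rightarrow> ('i, 'j, nat) kernel_elt
    \<Rightarrow> ('c, 'd, nat) kernel_elt"
where
  "reindex I J c d = (\<lambda>(\<kappa>1, \<kappa>2).
     (\<lambda>C \<in> c ` I. \<kappa>1 (inv_into I c C), \<lambda>C \<in> d ` J. \<kappa>2 (inv_into J d C)))"

text \<open>
  The action \<open>\<theta>\<close> of the symmetric group on \<open>q + 1\<close> letters, identified with that of the points
  by \<open>b\<close>, on a group \<open>K\<close> identified with \<open>twin_perms\<close> by \<open>\<iota>\<close>.
\<close>

definition theta ::
  "('a::{field,finite} vertex set \<Rightarrow> nat \<Rightarrow> 'a vertex) \<Rightarrow> (nat \<Rightarrow> 'a vertex)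
    \<Rightarrow> ('k, 'x) monoid_scheme
    \<Rightarrow> ('k \<Rightarrow> ('a vertex set, 'a vertex set, 'a vertex) kernel_elt)
    \<Rightarrow> (nat \<Rightarrow> nat) \<Rightarrow> 'k \<Rightarrow> 'k"
where
  "theta lab b K \<iota> =
     conj_action K sig_aut (twin_incl \<circ> \<iota>)
       (\<lambda>\<tau>. hat lab (perm_via b (CARD('a) + 1) points \<tau>))"

text \<open>
  \<open>Aut(SIG)\<close> is the semidirect product of \<open>K\<close> (identified with \<open>twin_perms\<close> by \<open>\<iota>\<close>) and the
  symmetric group on \<open>q + 1\<close> letters, for the conjugation action \<open>theta\<close>. The third conjunct
  says that every conjugate lies in the image of \<open>K\<close>, so that the \<open>inv_into\<close> in \<open>conj_action\<close>
  is meaningful.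
\<close>

definition semidirect_via ::
  "('a::{field,finite} vertex set \<Rightarrow> nat \<Rightarrow> 'a vertex) \<Rightarrow> (nat \<Rightarrow> 'a vertex)
    \<Rightarrow> ('k, 'x) monoid_scheme
    \<Rightarrow> ('k \<Rightarrow> ('a vertex set, 'a vertex set, 'a vertex) kernel_elt) \<Rightarrow> bool"
where
  "semidirect_via lab b K \<iota> \<longleftrightarrow>
     \<iota> \<in> iso K twin_perms \<and>
     theta lab b K \<iota> \<in> hom (sym_group (CARD('a) + 1)) (AutoGroup K) \<and>
     (\<forall>\<tau> \<in> carrier (sym_group (CARD('a) + 1)). \<forall>\<kappa> \<in> carrier K.
        let s = hat lab (perm_via b (CARD('a) + 1) points \<tau>) in
        twin_incl (\<iota> (theta lab b K \<iota> \<tau> \<kappa>)) =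
          s \<otimes>\<^bsub>sig_aut\<^esub> twin_incl (\<iota> \<kappa>) \<otimes>\<^bsub>sig_aut\<^esub> inv\<^bsub>sig_aut\<^esub> s) \<and>
     (sig_aut :: ('a vertex \<Rightarrow> 'a vertex) monoid) \<cong> semidirect K (theta lab b K \<iota>) (sym_group (CARD('a) + 1))"

end

theory Submission
  imports Defs
begin

text \<open>
  Everything rests on a normal form for the non-scalar operators with an eigenvector. If
  \<open>M v = a v\<close> with \<open>v \<noteq> 0\<close>, then \<open>M - a I\<close> kills \<open>v\<close>, so it has the form
  \<open>u \<mapsto> det (v, u) x\<close> for some vector \<open>x\<close>; thus \<open>M = a I + R\<close> where \<open>R\<close> is this map of rank
  at most one (\<open>E2_cases\<close>). If \<open>x \<noteq> 0\<close>, the eigenvectors of \<open>M\<close> are exactly the nonzero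
  multiples of \<open>v\<close> and of \<open>x\<close> (\<open>eigenvector_mat_plus_rank_one\<close>); the case of one eigendirection
  is \<open>\<langle>v\<rangle> = \<langle>x\<rangle>\<close>. Rescaling \<open>v\<close> or \<open>x\<close> rescales \<open>R\<close>, and exchanging them changes \<open>R\<close> by a
  scalar operator. Hence a set \<open>{\<langle>v\<rangle>, \<langle>x\<rangle>}\<close> of one or two points determines \<open>M\<close> up to
  scaling and up to adding a scalar operator, and it is the neighbourhood of exactly \<open>q\<close> vertices,
  the lines of \<open>b I + R\<close> with \<open>b\<close> in the field (\<open>ops_with_pair\<close>). The only other operator vertex is
  the identity line, which is adjacent to all \<open>q + 1 \<ge> 3\<close> points. So the classes in \<open>T1\<close> and
  \<open>T2\<close> correspond to the subsets of the points with one and two elements.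

  An automorphism cannot exchange the two parts: an operator has at most \<open>q + 1\<close> neighbours, while
  a point \<open>p\<close> is adjacent to the \<open>2 q > q + 1\<close> operators whose neighbourhood is \<open>{p}\<close> or
  \<open>{p, r}\<close> for some fixed other point \<open>r\<close>. Therefore automorphisms restrict to permutations of the
  points. An automorphism that fixes every point preserves the neighbourhood of every operator,
  hence permutes each twin class and fixes the identity line; and every family of permutations of
  the twin classes arises in this way (\<open>twin_incl_kernel\<close>). In the other direction, a permutation
  of the points permutes the sets of one or two points and is lifted by moving the \<open>i\<close>-th operator
  over \<open>X\<close> to the \<open>i\<close>-th operator over the image of \<open>X\<close>. Keeping the label makes this lift
  multiplicative (\<open>hat_compose\<close>), so the sequence is exact and splits.

  The remaining claims are group theory: a split extension is the semidirect product for the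
  conjugation action (\<open>semidirect_iso\<close>), and this may be transported along the isomorphisms that
  identify \<open>S\<^sub>q\<close> with the symmetric group of a twin class and \<open>S\<close> on \<open>q + 1\<close> letters with
  that of the points.
\<close>

section \<open>Operators on the plane\<close>

lemma mat_line_eq: "mat_line M = range (\<lambda>c. mat_scale c M)"
proof -
  interpret module "mat_scale :: 'a \<Rightarrow> 'a^2^2 \<Rightarrow> 'a^2^2"
    by unfold_locales (simp_all add: mat_scale_def vec_eq_iff algebra_simps)
  show ?thesis
    by (simp add: mat_line_def span_singleton)
qed

lemma vec_line_eq: "vec_line v = range (\<lambda>c. c *s v)"
  by (simp add: vec_line_def vec.span_singleton)

lemma mat_scale_mult_vec: "mat_scale c M *v v = c *s (M *v v)"
  by (simp add: mat_scale_def vec_eq_iff matrix_vector_mult_def sum_distrib_left algebra_simps)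

lemma mat_scale_mat_scale: "mat_scale c (mat_scale d M) = mat_scale (c * d) M"
  by (simp add: mat_scale_def vec_eq_iff algebra_simps)

lemma mat_scale_1 [simp]: "mat_scale 1 M = M"
  by (simp add: mat_scale_def vec_eq_iff)

lemma mat_line_mat_scale:
  assumes "c \<noteq> 0"
  shows "mat_line (mat_scale c M) = mat_line M"
proof -
  have "mat_scale d M \<in> range (\<lambda>d. mat_scale (d * c) M)" for d
    using assms by (intro range_eqI[of _ _ "d / c"]) simp
  then show ?thesis
    by (auto simp: mat_line_eq mat_scale_mat_scale)
qed

lemma mat_line_eqD:
  assumes "mat_line M = mat_line M'"
  obtains c where "M = mat_scale c M'"
proof -
  have "M \<in> mat_line M"
    unfolding mat_line_eq by (rule range_eqI[of _ _ 1]) simp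
  then show ?thesis
    using that assms unfolding mat_line_eq by auto
qed

lemma mat_2_eq_iff:
  "(M :: 'a^2^2) = N \<longleftrightarrow> M$1$1 = N$1$1 \<and> M$1$2 = N$1$2 \<and> M$2$1 = N$2$1 \<and> M$2$2 = N$2$2"
  by (auto simp: vec_eq_iff forall_2)

lemma vec_2_eq_iff: "(v :: 'a^2) = w \<longleftrightarrow> v$1 = w$1 \<and> v$2 = w$2"
  by (auto simp: vec_eq_iff forall_2)

definition det2 :: "'a::field^2 \<Rightarrow> 'a^2 \<Rightarrow> 'a" where
  "det2 v w = v$1 * w$2 - v$2 * w$1"

lemma det2_self [simp]: "det2 v v = 0"
  by (simp add: det2_def)

lemma det2_scale [simp]: "det2 v (c *s w) = c * det2 v w" "det2 (c *s v) w = c * det2 v w"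
  by (simp_all add: det2_def algebra_simps)

lemma det2_eq_0D:
  assumes "v \<noteq> 0" "det2 v w = 0"
  obtains c where "w = c *s v"
proof (cases "v$1 = 0")
  case True
  with assms show ?thesis
    by (intro that[of "w$2 / v$2"]) (auto simp: det2_def vec_2_eq_iff)
next
  case False
  with assms show ?thesis
    by (intro that[of "w$1 / v$1"]) (auto simp: det2_def vec_2_eq_iff field_simps)
qed

text \<open>
  Linear dependence in the plane is the vanishing of a determinant, which turns all questions about
  eigendirections below into polynomial identities.
\<close>
lemma vec_line_eq_iff:
  assumes "v \<noteq> 0" "w \<noteq> 0"
  shows "vec_line v = vec_line w \<longleftrightarrow> det2 v w = 0"
proof
  assume eq: "vec_line v = vec_line w"
  have "w \<in> vec_line w"
    unfolding vec_line_eq by (rule range_eqI[of _ _ 1]) simp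
  then obtain c where "w = c *s v"
    unfolding eq[symmetric] by (auto simp: vec_line_eq)
  then show "det2 v w = 0" by simp
next
  assume "det2 v w = 0"
  then obtain c where w: "w = c *s v"
    using det2_eq_0D assms(1) by blast
  with assms have "c \<noteq> 0" by auto
  then have "d *s v \<in> range (\<lambda>d. d *s w)" for d
    by (intro range_eqI[of _ _ "d / c"]) (simp add: w)
  then show "vec_line v = vec_line w"
    by (auto simp: vec_line_eq w)
qed

lemma vec_line_eqD:
  assumes "v \<noteq> 0" "w \<noteq> 0" "vec_line v = vec_line w"
  obtains c where "w = c *s v"
  using assms det2_eq_0D vec_line_eq_iff by blast

lemma eigenvector_iff: "eigenvector M v \<longleftrightarrow> v \<noteq> 0 \<and> det2 v (M *v v) = 0"
  unfolding eigenvector_def by (metis det2_eq_0D det2_scale(1) det2_self mult_zero_right)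

lemma mat_mult_vec: "mat a *v v = a *s v" for v :: "'a::field^2"
  by (simp add: vec_2_eq_iff matrix_vector_mult_def sum_2 mat_def)

text \<open>The matrix of the map \<open>u \<mapsto> det2 v u *s x\<close>.\<close>
definition rank_one :: "'a::field^2 \<Rightarrow> 'a^2 \<Rightarrow> 'a^2^2" where
  "rank_one v x = (\<chi> i j. if j = 1 then - x$i * v$2 else x$i * v$1)"

lemma rank_one_nth [simp]:
  "rank_one v x $ i $ 1 = - x$i * v$2" "rank_one v x $ i $ 2 = x$i * v$1"
  by (simp_all add: rank_one_def)

lemma mat_nth [simp]: "(mat a :: 'a::zero^2^2) $1$1 = a" "(mat a :: 'a^2^2) $1$2 = 0" 
  "(mat a :: 'a^2^2) $2$1 = 0" "(mat a :: 'a^2^2) $2$2 = a"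
  by (simp_all add: mat_def)

lemma rank_one_mult_vec: "rank_one v x *v u = det2 v u *s x"
  by (simp add: vec_2_eq_iff matrix_vector_mult_def sum_2 det2_def algebra_simps)

lemma rank_one_scale: "rank_one (c *s v) (d *s x) = mat_scale (c * d) (rank_one v x)"
  by (simp add: mat_2_eq_iff mat_scale_def)

text \<open>
  This is the identity \<open>det (x, u) v + det (u, v) x + det (v, x) u = 0\<close>, which holds because any
  three vectors of a plane are dependent.
\<close>
lemma rank_one_swap: "rank_one x v = mat (- det2 v x) + rank_one v x"
  by (simp add: mat_2_eq_iff det2_def algebra_simps)

text \<open>
  When the non-scalar part of an operator is rescaled, the factor can be moved to the scalar part.
\<close>
lemma mat_line_mat_plus_scale:
  assumes "k \<noteq> 0"
  shows "mat_line (mat a + mat_scale k M) = mat_line (mat (a / k) + M)"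
proof -
  have "mat a + mat_scale k M = mat_scale k (mat (a / k) + M)"
    using assms by (simp add: mat_2_eq_iff mat_scale_def distrib_left)
  then show ?thesis
    using mat_line_mat_scale[OF assms] by simp
qed

text \<open>
  For \<open>M = mat a + rank_one v x\<close> the determinant of \<open>u\<close> and \<open>M u\<close> is, up to sign, the product
  \<open>det2 u v * det2 u x\<close>; it vanishes iff \<open>u\<close> is parallel to \<open>v\<close> or to \<open>x\<close>.
\<close>
lemma eigenvector_mat_plus_rank_one:
  assumes "v \<noteq> 0" "x \<noteq> 0"
  shows "eigenvector (mat a + rank_one v x) u \<longleftrightarrow> 
    u \<noteq> 0 \<and> (vec_line u = vec_line v \<or> vec_line u = vec_line x)"
proof -
  have "det2 u ((mat a + rank_one v x) *v u) = - (det2 u v * det2 u x)"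
    by (simp add: matrix_vector_mult_add_rdistrib mat_mult_vec rank_one_mult_vec)
      (simp add: det2_def algebra_simps)
  then show ?thesis
    using assms vec_line_eq_iff[of u v] vec_line_eq_iff[of u x]
    by (simp add: eigenvector_iff) blast
qed

lemma mat_plus_rank_one_nonscalar:
  assumes "v \<noteq> 0" "x \<noteq> 0"
  shows "mat a + rank_one v x \<noteq> mat b"
  using assms by (auto simp: mat_2_eq_iff vec_2_eq_iff)

lemma mat_plus_rank_one_in_E2:
  assumes "v \<noteq> 0" "x \<noteq> 0"
  shows "mat a + rank_one v x \<in> E2"
  using assms mat_plus_rank_one_nonscalar[OF assms, of a 0] eigenvector_mat_plus_rank_one[OF assms, of a v]
  by (auto simp: E2_def)

lemma mat_in_E2: "b \<noteq> 0 \<Longrightarrow> mat b \<in> E2"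
proof -
  assume "b \<noteq> 0"
  moreover have "eigenvector (mat b :: 'a^2^2) (axis 1 1)"
    by (simp add: eigenvector_iff mat_mult_vec)
  ultimately show ?thesis
    by (auto simp: E2_def mat_2_eq_iff)
qed

text \<open>
  With an eigenvector \<open>v\<close> for the eigenvalue \<open>a\<close>, every row of \<open>M - mat a\<close> is orthogonal to
  \<open>v\<close> and therefore a multiple of \<open>(- v$2, v$1)\<close>; the two factors are the coordinates of \<open>x\<close>.
\<close>
lemma E2_cases:
  assumes "M \<in> E2"
  obtains (scalar) b where "b \<noteq> 0" "M = mat b"
    | (nonscalar) a v x where "v \<noteq> 0" "x \<noteq> 0" "M = mat a + rank_one v x"
proof -
  from assms obtain v a where "v \<noteq> 0" and v: "M *v v = a *s v" and "M \<noteq> 0"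
    by (auto simp: E2_def eigenvector_def)
  have "\<exists>x. M = mat a + rank_one v x"
  proof (cases "v$1 = 0")
    case True
    with \<open>v \<noteq> 0\<close> have "v$2 \<noteq> 0" by (simp add: vec_2_eq_iff)
    with v True show ?thesis
      by (intro exI[of _ "vector [(a - M$1$1) / v$2, - M$2$1 / v$2]"])
        (auto simp: mat_2_eq_iff vec_2_eq_iff matrix_vector_mult_def sum_2)
  next
    case False
    with v show ?thesis
      by (intro exI[of _ "vector [M$1$2 / v$1, (M$2$2 - a) / v$1]"])
        (auto simp: mat_2_eq_iff vec_2_eq_iff matrix_vector_mult_def sum_2 field_simps)
  qed
  then obtain x where M: "M = mat a + rank_one v x" by blast
  show ?thesis
  proof (cases "x = 0")
    case True
    then have "M = mat a"
      unfolding M by (simp add: mat_2_eq_iff)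
    with \<open>M \<noteq> 0\<close> show ?thesis
      by (intro scalar[of a]) (auto simp: mat_2_eq_iff)
  qed (use M \<open>v \<noteq> 0\<close> nonscalar in blast)
qed

section \<open>Neighbourhoods and the number of points\<close>

text \<open>
  Adjacency quantifies over all generators of a line of operators, but any two of them are
  proportional and so have the same eigenvectors.
\<close>
lemma sig_nbhd_op:
  assumes "M \<in> E2"
  shows "sig_nbhd (Inl (mat_line M)) = {Inr (vec_line v) |v. eigenvector M v}"
proof -
  have "eigenvector M v" if "mat_line M = mat_line M'" "eigenvector M' v" for M' v
  proof -
    obtain c where "M = mat_scale c M'"
      using \<open>mat_line M = mat_line M'\<close> by (rule mat_line_eqD)
    with that show ?thesis
      by (simp add: eigenvector_iff mat_scale_mult_vec)
  qed
  moreover have "Inr (vec_line v) \<in> sig_verts" if "eigenvector M v" for v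
    using that by (auto simp: sig_verts_def P_lines_def eigenvector_def)
  ultimately show ?thesis
    using assms unfolding nbhd_def sig_adj_def by auto
qed

abbreviation pt :: "'a::field^2 \<Rightarrow> 'a vertex" where
  "pt v \<equiv> Inr (vec_line v)"

lemma points_eq: "points = pt ` {v. v \<noteq> 0}"
  by (simp add: points_def P_lines_def image_image)

lemma sig_nbhd_scalar:
  assumes "b \<noteq> 0"
  shows "sig_nbhd (Inl (mat_line (mat b))) = points"
  using assms by (auto simp: sig_nbhd_op mat_in_E2 eigenvector_iff mat_mult_vec points_eq)

lemma sig_nbhd_nonscalar:
  assumes "v \<noteq> 0" "x \<noteq> 0"
  shows "sig_nbhd (Inl (mat_line (mat a + rank_one v x))) = {pt v, pt x}"
  using assms
  by (auto simp: sig_nbhd_op mat_plus_rank_one_in_E2 eigenvector_mat_plus_rank_one)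

text \<open>
  The points are represented by \<open>(0, 1)\<close> and by the vectors \<open>(1, t)\<close>.
\<close>
lemma card_points: "card (points :: 'a::{field,finite} vertex set) = CARD('a) + 1"
proof -
  define e :: "'a option \<Rightarrow> 'a^2" where
    "e = (\<lambda>t. case t of None \<Rightarrow> vector [0, 1] | Some t \<Rightarrow> vector [1, t])"
  have nz: "e t \<noteq> 0" for t
    by (cases t) (auto simp: e_def vec_2_eq_iff)
  have inj: "inj (\<lambda>t. pt (e t))"
  proof (rule injI)
    fix s t assume "pt (e s) = pt (e t)"
    then have "det2 (e s) (e t) = 0"
      using vec_line_eq_iff[OF nz nz] by simp
    then show "s = t"
      by (cases s; cases t) (auto simp: e_def det2_def)
  qed
  have "pt v \<in> range (\<lambda>t. pt (e t))" if "v \<noteq> 0" for v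
  proof -
    have "det2 v (e (if v$1 = 0 then None else Some (v$2 / v$1))) = 0"
      by (simp add: e_def det2_def)
    then have "vec_line v = vec_line (e (if v$1 = 0 then None else Some (v$2 / v$1)))"
      using vec_line_eq_iff[OF that nz] by blast
    then show ?thesis
      by (intro range_eqI) (rule arg_cong[of _ _ Inr])
  qed
  then have "points = range (\<lambda>t. pt (e t))"
    using nz by (auto simp: points_eq)
  then have "card (points :: (('a^2^2) set + ('a^2) set) set) = CARD('a option)"
    using card_image[OF inj] by simp
  then show ?thesis by simp
qed

lemma card_field_ge_2: "CARD('a::{field,finite}) \<ge> 2"
  using card_mono[of UNIV "{0, 1 :: 'a}"] by simp

lemma finite_points: "finite (points :: 'a::{field,finite} vertex set)"
  by (rule card_ge_0_finite) (simp add: card_points)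

lemma ops_cases:
  assumes "y \<in> ops"
  obtains (scalar) "y = Inl (mat_line (mat 1))"
    | (nonscalar) a v x where "v \<noteq> 0" "x \<noteq> 0" "y = Inl (mat_line (mat a + rank_one v x))"
proof -
  obtain M where "M \<in> E2" and y: "y = Inl (mat_line M)"
    using assms by (auto simp: ops_def E_lines_def)
  from \<open>M \<in> E2\<close> show ?thesis
  proof (cases rule: E2_cases)
    case (scalar b)
    have "mat b = mat_scale b (mat 1 :: 'a^2^2)"
      by (simp add: mat_2_eq_iff mat_scale_def)
    with scalar y show ?thesis
      using mat_line_mat_scale that(1) by metis
  qed (use y that(2) in blast)
qed

text \<open>
  The two-element case and, for \<open>vec_line v = vec_line x\<close>, the one-element case are treated
  together. An operator with these eigendirections is non-scalar, since a scalar one has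
  \<open>q + 1 \<ge> 3\<close> neighbours; its normal form uses the same two directions, in the same order or in
  the opposite one.
\<close>
lemma ops_with_pair:
  fixes v x :: "'a::{field,finite}^2"
  assumes "v \<noteq> 0" "x \<noteq> 0"
  shows "ops_with {pt v, pt x} = range (\<lambda>b. Inl (mat_line (mat b + rank_one v x)))"
proof
  show "range (\<lambda>b. Inl (mat_line (mat b + rank_one v x))) \<subseteq> ops_with {pt v, pt x}"
    using assms mat_plus_rank_one_in_E2[OF assms]
    by (auto simp: ops_with_def sig_nbhd_nonscalar ops_def E_lines_def)
  show "ops_with {pt v, pt x} \<subseteq> range (\<lambda>b. Inl (mat_line (mat b + rank_one v x)))"
  proof
    fix y assume "y \<in> ops_with {pt v, pt x}"
    then have "y \<in> ops" and nb: "sig_nbhd y = {pt v, pt x}"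
      by (auto simp: ops_with_def)
    from \<open>y \<in> ops\<close> show "y \<in> range (\<lambda>b. Inl (mat_line (mat b + rank_one v x)))"
    proof (cases rule: ops_cases)
      case scalar
      then have "card {pt v, pt x} = CARD('a) + 1"
        using nb sig_nbhd_scalar[of 1] card_points by (metis zero_neq_one)
      moreover have "card {pt v, pt x} \<le> 2"
        by (simp add: card_insert_le_m1)
      ultimately show ?thesis
        using card_field_ge_2[where 'a = 'a] by linarith
    next
      case (nonscalar a w z)
      have "{pt w, pt z} = {pt v, pt x}"
        using nb unfolding nonscalar(3) sig_nbhd_nonscalar[OF nonscalar(1,2)] by simp
      then consider "vec_line v = vec_line w" "vec_line x = vec_line z"
        | "vec_line v = vec_line z" "vec_line x = vec_line w"
        by (auto simp only: doubleton_eq_iff sum.inject)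
      then show ?thesis
      proof cases
        case 1
        obtain c where c: "w = c *s v"
          using vec_line_eqD[OF assms(1) nonscalar(1) 1(1)] .
        obtain d where d: "z = d *s x"
          using vec_line_eqD[OF assms(2) nonscalar(2) 1(2)] .
        have "c * d \<noteq> 0"
          using nonscalar(1,2) c d by auto
        then have "mat_line (mat a + rank_one w z) = mat_line (mat (a / (c * d)) + rank_one v x)"
          unfolding c d rank_one_scale by (rule mat_line_mat_plus_scale)
        then show ?thesis
          unfolding nonscalar(3) by (intro range_eqI) (rule arg_cong[of _ _ Inl])
      next
        case 2
        \<comment> \<open>Exchanging the two directions costs the scalar \<open>- det2 v x\<close>.\<close>
        obtain c where c: "w = c *s x"
          using vec_line_eqD[OF assms(2) nonscalar(1) 2(2)] .
        obtain d where d: "z = d *s v"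
          using vec_line_eqD[OF assms(1) nonscalar(2) 2(1)] .
        have "c * d \<noteq> 0"
          using nonscalar(1,2) c d by auto
        then have "mat_line (mat a + rank_one w z) =
            mat_line (mat (a / (c * d)) + (mat (- det2 v x) + rank_one v x))"
          unfolding c d rank_one_scale rank_one_swap[of x v] by (rule mat_line_mat_plus_scale)
        also have "mat (a / (c * d)) + (mat (- det2 v x) + rank_one v x) =
            mat (a / (c * d) - det2 v x) + rank_one v x"
          by (simp add: mat_2_eq_iff)
        finally show ?thesis
          unfolding nonscalar(3) by (intro range_eqI) (rule arg_cong[of _ _ Inl])
      qed
    qed
  qed
qed

text \<open>
  Different scalars give different lines because \<open>rank_one v x\<close> and the identity are linearly
  independent.
\<close>
lemma inj_mat_line_mat_plus_rank_one:
  assumes "v \<noteq> 0" "x \<noteq> 0"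
  shows "inj (\<lambda>b. mat_line (mat b + rank_one v x))"
proof (rule injI)
  fix b b' assume "mat_line (mat b + rank_one v x) = mat_line (mat b' + rank_one v x)"
  then obtain c where c: "mat b + rank_one v x = mat_scale c (mat b' + rank_one v x)"
    by (rule mat_line_eqD)
  have "c = 1"
  proof (rule ccontr)
    assume "c \<noteq> 1"
    then have "mat 0 + rank_one v x = mat ((c * b' - b) / (1 - c))"
      using c by (auto simp: mat_2_eq_iff mat_scale_def field_simps)
    then show False
      using mat_plus_rank_one_nonscalar[OF assms] by blast
  qed
  with c show "b = b'"
    by (simp add: mat_2_eq_iff)
qed

lemma card_ops_with:
  fixes X :: "'a::{field,finite} vertex set"
  assumes "X \<subseteq> points" "1 \<le> card X" "card X \<le> 2"
  shows "card (ops_with X) = CARD('a)"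
proof -
  have "card X = 1 \<or> card X = 2" using assms by linarith
  then have "\<exists>p q. X = {p, q}"
    by (metis card_1_singletonE card_2_iff insert_absorb2)
  with assms(1) obtain v x where X: "X = {pt v, pt x}" and nz: "v \<noteq> 0" "x \<noteq> 0"
    by (auto simp: points_eq)
  have "inj (\<lambda>b. Inl (mat_line (mat b + rank_one v x)) :: 'a vertex)"
    using inj_mat_line_mat_plus_rank_one[OF nz] by (auto simp: inj_def)
  then show ?thesis
    unfolding X ops_with_pair[OF nz] by (simp add: card_image)
qed

section \<open>Operators sorted by their neighbourhood\<close>

abbreviation id_op :: "'a::field vertex" where
  "id_op \<equiv> Inl (mat_line (mat 1))"

lemma sig_verts_eq: "sig_verts = ops \<union> points"
  by (auto simp: sig_verts_def ops_def points_def)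

lemma ops_points_disjoint: "x \<in> ops \<Longrightarrow> x \<in> points \<Longrightarrow> False"
  by (auto simp: ops_def points_def)

lemma sig_adj_commute: "sig_adj x y \<longleftrightarrow> sig_adj y x"
  unfolding sig_adj_def by blast

lemma sig_adj_bipartite:
  assumes "sig_adj x y"
  shows "x \<in> ops \<and> y \<in> points \<or> x \<in> points \<and> y \<in> ops"
  using assms unfolding sig_adj_def ops_def points_eq E_lines_def
  by (auto simp: eigenvector_def)

lemma mem_sig_nbhd: "y \<in> sig_nbhd x \<longleftrightarrow> sig_adj x y"
  using sig_adj_bipartite[of x y] by (auto simp: nbhd_def sig_verts_eq)

lemma sig_nbhd_op_subset: "x \<in> ops \<Longrightarrow> sig_nbhd x \<subseteq> points"
  using sig_adj_bipartite ops_points_disjoint by (fastforce simp: mem_sig_nbhd)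

lemma id_op_in_ops: "id_op \<in> ops"
  using mat_in_E2[of 1] by (auto simp: ops_def E_lines_def)

lemma sig_nbhd_id_op: "sig_nbhd id_op = points"
  by (rule sig_nbhd_scalar) simp

text \<open>
  These turn out to be the neighbourhoods of the operators other than the identity line.
\<close>
definition small_sets :: "'a::field vertex set set" where
  "small_sets = {X. X \<subseteq> points \<and> 1 \<le> card X \<and> card X \<le> 2}"

lemma points_not_small: "(points :: 'a::{field,finite} vertex set) \<notin> small_sets"
  using card_field_ge_2[where 'a = 'a] by (simp add: small_sets_def card_points)

lemma sig_nbhd_small:
  assumes "x \<in> ops" "x \<noteq> id_op"
  shows "sig_nbhd x \<in> small_sets"
  using assms(1)
proof (cases rule: ops_cases)
  case scalar
  with assms(2) show ?thesis by blast
next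
  case (nonscalar a v w)
  have "card {pt v, pt w} \<le> 2"
    by (simp add: card_insert_le_m1)
  moreover have "card {pt v, pt w} \<ge> 1"
    by (simp add: card_gt_0_iff Suc_le_eq)
  ultimately show ?thesis
    using sig_nbhd_nonscalar[OF nonscalar(1,2), of a] nonscalar sig_nbhd_op_subset[OF assms(1)]
    by (simp add: small_sets_def)
qed

lemma ops_with_small:
  fixes x :: "'a::{field,finite} vertex"
  assumes "X \<in> small_sets" "x \<in> ops_with X"
  shows "x \<in> ops" "sig_nbhd x = X" "x \<notin> points" "x \<noteq> id_op"
  using assms points_not_small ops_points_disjoint[of x]
  by (auto simp: ops_with_def sig_nbhd_id_op)

text \<open>
  This case distinction organises all later proofs: a map that preserves the neighbourhoods of
  operators acts separately on the points, on the identity line and on each \<open>ops_with X\<close>.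
\<close>
lemma sig_verts_cases:
  fixes x :: "'a::{field,finite} vertex"
  assumes "x \<in> sig_verts"
  obtains (point) "x \<in> points"
    | (id_op) "x = id_op"
    | (small) X where "X \<in> small_sets" "x \<in> ops_with X"
  using assms sig_nbhd_small[of x] by (auto simp: sig_verts_eq ops_with_def)

lemma card_ops_with_small:
  "X \<in> small_sets \<Longrightarrow> card (ops_with X) = CARD('a)" for X :: "'a::{field,finite} vertex set"
  by (simp add: small_sets_def card_ops_with)

lemma ops_with_nonempty:
  fixes X :: "'a::{field,finite} vertex set"
  assumes "X \<in> small_sets"
  obtains x where "x \<in> ops_with X"
proof -
  have "card (ops_with X) > 0"
    using assms by (simp add: card_ops_with_small)
  then show ?thesis
    using that by (auto simp: card_gt_0_iff)
qed

lemma inj_ops_with: "inj_on ops_with (small_sets :: 'a::{field,finite} vertex set set)"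
proof (rule inj_onI)
  fix X Y :: "'a vertex set"
  assume XY: "X \<in> small_sets" "Y \<in> small_sets" "ops_with X = ops_with Y"
  obtain x where "x \<in> ops_with X"
    using XY(1) by (rule ops_with_nonempty)
  then show "X = Y"
    using XY(3) unfolding ops_with_def by blast
qed

lemma Union_sig_nbhd_ops_with:
  fixes X :: "'a::{field,finite} vertex set"
  assumes "X \<in> small_sets"
  shows "(\<Union>x\<in>ops_with X. sig_nbhd x) = X"
proof -
  obtain x where "x \<in> ops_with X"
    using assms by (rule ops_with_nonempty)
  then show ?thesis
    unfolding ops_with_def by blast
qed


section \<open>Twin classes\<close>

lemma sig_nbhd_op_nonempty: 
  assumes "x \<in> ops"
  shows "sig_nbhd x \<noteq> {}"
proof -
  have "(points :: 'a vertex set) \<noteq> {}" "({} :: 'a vertex set) \<notin> small_sets"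
    by (auto simp: points_eq small_sets_def intro: exI[of _ "axis 1 1"])
  then show ?thesis
    using sig_nbhd_small[OF assms] sig_nbhd_id_op by metis
qed

text \<open>
  A twin class is taken among all vertices, but a point is never a twin of an operator, because
  their neighbourhoods are nonempty and lie in different parts.
\<close>
lemma twin_class_op:
  assumes "x \<in> ops"
  shows "sig_twins `` {x} = ops_with (sig_nbhd x)"
proof -
  have "y \<in> ops" if "y \<in> sig_verts" "sig_nbhd y = sig_nbhd x" for y
  proof -
    obtain p where "p \<in> sig_nbhd x"
      using sig_nbhd_op_nonempty[OF assms] by blast
    moreover from this have "p \<in> points"
      using sig_nbhd_op_subset[OF assms] by blast
    ultimately have "sig_adj y p" "p \<in> points"
      using that by (simp_all flip: mem_sig_nbhd)
    then show ?thesis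
      using sig_adj_bipartite ops_points_disjoint by blast
  qed
  then show ?thesis
    using assms unfolding twin_rel_def ops_with_def by (auto simp: sig_verts_eq)
qed

lemma op_twin_classes_eq:
  assumes "k = 1 \<or> k = 2"
  shows "op_twin_classes k = ops_with ` {X :: 'a::{field,finite} vertex set. X \<subseteq> points \<and> card X = k}"
proof (intro equalityI subsetI)
  fix C :: "'a vertex set" assume "C \<in> op_twin_classes k"
  then obtain x where x: "x \<in> sig_verts" "C = sig_twins `` {x}" 
    and C: "C \<subseteq> ops" "\<forall>x\<in>C. card (sig_nbhd x) = k"
    by (auto simp: op_twin_classes_def quotient_def)
  then have "x \<in> C"
    by (auto simp: twin_rel_def)
  with C have "x \<in> ops" "card (sig_nbhd x) = k" by auto
  then show "C \<in> ops_with ` {X. X \<subseteq> points \<and> card X = k}"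
    using x twin_class_op sig_nbhd_op_subset by blast
next
  fix C :: "'a vertex set" assume "C \<in> ops_with ` {X. X \<subseteq> points \<and> card X = k}"
  then obtain X where X: "X \<subseteq> points" "card X = k" and C: "C = ops_with X"
    by blast
  then have "X \<in> small_sets"
    using assms by (auto simp: small_sets_def)
  then obtain x where x: "x \<in> ops_with X"
    by (rule ops_with_nonempty)
  have "x \<in> ops" "sig_nbhd x = X"
    using x by (auto simp: ops_with_def)
  then have "C = sig_twins `` {x}" "x \<in> sig_verts"
    using twin_class_op C by (auto simp: sig_verts_eq)
  then have "C \<in> sig_verts // sig_twins"
    by (auto simp: quotient_def)
  then show "C \<in> op_twin_classes k"
    using C X by (auto simp: op_twin_classes_def ops_with_def)
qed

lemma card_op_twin_classes:
  assumes "k = 1 \<or> k = 2"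
  shows "card (op_twin_classes k :: 'a::{field,finite} vertex set set) = (CARD('a) + 1) choose k"
proof -
  have "{X :: 'a vertex set. X \<subseteq> points \<and> card X = k} \<subseteq> small_sets"
    using assms by (auto simp: small_sets_def)
  then have "card (op_twin_classes k :: 'a vertex set set) = 
      card {X :: 'a vertex set. X \<subseteq> points \<and> card X = k}"
    unfolding op_twin_classes_eq[OF assms] by (intro card_image inj_on_subset[OF inj_ops_with])
  also have "\<dots> = (CARD('a) + 1) choose k"
    by (simp add: n_subsets[OF finite_points] card_points)
  finally show ?thesis .
qed

lemma T1_T2_eq: "T1 \<union> T2 = ops_with ` (small_sets :: 'a::{field,finite} vertex set set)"
proof -
  have *: "small_sets = {X :: 'a vertex set. X \<subseteq> points \<and> card X = 1} \<union> {X. X \<subseteq> points \<and> card X = 2}"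
    by (auto simp: small_sets_def)
  show ?thesis
    unfolding * image_Un by (simp add: op_twin_classes_eq)
qed

lemma T1_T2_disjoint:
  fixes C :: "'a::{field,finite} vertex set"
  assumes "C \<in> T1" "C \<in> T2"
  shows False
proof -
  from \<open>C \<in> T1\<close> obtain X where X: "card X = 1" "X \<subseteq> points" "C = ops_with X"
    by (auto simp: op_twin_classes_eq)
  then obtain x where "x \<in> C"
    using ops_with_nonempty[of X] by (auto simp: small_sets_def)
  then show False
    using assms by (simp add: op_twin_classes_def)
qed

lemma twin_class_cases:
  fixes C :: "'a::{field,finite} vertex set"
  assumes "C \<in> T1 \<union> T2"
  obtains X where "X \<in> small_sets" "C = ops_with X"
  using assms unfolding T1_T2_eq by blast


section \<open>Graph automorphisms\<close>

lemma mult_BijGroup: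
  "f \<in> Bij S \<Longrightarrow> g \<in> Bij S \<Longrightarrow> f \<otimes>\<^bsub>BijGroup S\<^esub> g = compose S f g"
  by (simp add: BijGroup_def)

lemma carrier_BijGroup [simp]: "carrier (BijGroup S) = Bij S"
  by (simp add: BijGroup_def)

lemma one_BijGroup: "\<one>\<^bsub>BijGroup S\<^esub> = (\<lambda>x\<in>S. x)"
  by (simp add: BijGroup_def)

lemma mem_graph_aut:
  "f \<in> carrier (graph_aut V E) \<longleftrightarrow> f \<in> Bij V \<and> (\<forall>x\<in>V. \<forall>y\<in>V. E (f x) (f y) \<longleftrightarrow> E x y)"
  by (simp add: graph_aut_def)

text \<open>
  The inverse of an adjacency-preserving bijection preserves adjacency as well, since adjacency is
  preserved in both directions.
\<close>
lemma group_graph_aut: "group (graph_aut V E)"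
proof -
  have "subgroup {f \<in> Bij V. \<forall>x\<in>V. \<forall>y\<in>V. E (f x) (f y) \<longleftrightarrow> E x y} (BijGroup V)"
    (is "subgroup ?A _")
  proof (rule subgroup.intro)
    show "?A \<subseteq> carrier (BijGroup V)" by auto
    show "\<one>\<^bsub>BijGroup V\<^esub> \<in> ?A"
      by (simp add: one_BijGroup id_Bij)
    show "f \<otimes>\<^bsub>BijGroup V\<^esub> g \<in> ?A" if "f \<in> ?A" "g \<in> ?A" for f g
      using that Bij_imp_funcset[of g V]
      by (auto simp: mult_BijGroup compose_Bij compose_eq Pi_iff)
    show "inv\<^bsub>BijGroup V\<^esub> f \<in> ?A" if f: "f \<in> ?A" for f
    proof -
      have im: "f ` V = V"
        using f by (auto simp: Bij_def bij_betw_def)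
      have "E (inv_into V f x) (inv_into V f y) \<longleftrightarrow> E x y" if "x \<in> V" "y \<in> V" for x y
      proof -
        have "inv_into V f x \<in> V" "inv_into V f y \<in> V"
          "f (inv_into V f x) = x" "f (inv_into V f y) = y"
          using that im by (simp_all add: inv_into_into f_inv_into_f)
        then show ?thesis
          using f by fastforce
      qed
      then show ?thesis
        using f by (auto simp: inv_BijGroup restrict_inv_into_Bij)
    qed
  qed
  then show ?thesis
    unfolding graph_aut_def by (rule subgroup.subgroup_is_group) (rule group_BijGroup)
qed

lemma group_sig_aut: "group sig_aut"
  by (simp add: sig_aut_def group_graph_aut)

lemma sig_aut_in_Bij: "f \<in> carrier sig_aut \<Longrightarrow> f \<in> Bij sig_verts"
  by (simp add: sig_aut_def mem_graph_aut)

lemma sig_aut_mult: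
  "f \<in> carrier sig_aut \<Longrightarrow> g \<in> carrier sig_aut \<Longrightarrow> f \<otimes>\<^bsub>sig_aut\<^esub> g = compose sig_verts f g"
  using mult_BijGroup[of f sig_verts g] by (simp add: sig_aut_def graph_aut_def)

lemma sig_nbhd_aut:
  assumes f: "f \<in> carrier sig_aut" and x: "x \<in> sig_verts"
  shows "sig_nbhd (f x) = f ` sig_nbhd x"
proof -
  have adj: "\<And>y. y \<in> sig_verts \<Longrightarrow> sig_adj (f x) (f y) \<longleftrightarrow> sig_adj x y"
    and im: "f ` sig_verts = sig_verts"
    using f x by (auto simp: sig_aut_def mem_graph_aut Bij_def bij_betw_def)
  show ?thesis
  proof (intro equalityI subsetI)
    fix z assume "z \<in> sig_nbhd (f x)"
    then have "z \<in> f ` sig_verts" "sig_adj (f x) z"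
      by (simp_all add: nbhd_def im)
    then show "z \<in> f ` sig_nbhd x"
      by (auto simp: nbhd_def adj)
  next
    fix z assume "z \<in> f ` sig_nbhd x"
    then obtain y where "z = f y" "y \<in> sig_verts" "sig_adj x y"
      by (auto simp: nbhd_def)
    moreover from this have "f y \<in> sig_verts"
      by (metis im imageI)
    ultimately show "z \<in> sig_nbhd (f x)"
      by (simp add: nbhd_def adj)
  qed
qed

text \<open>
  Together with the next lemma, this separates the two parts by their degrees. The bound comes from
  the \<open>q\<close> operators over \<open>{p}\<close> and the \<open>q\<close> operators over \<open>{p, r}\<close>, and \<open>2 q > q + 1\<close>.
\<close>
lemma card_sig_nbhd_point:
  fixes p :: "'a::{field,finite} vertex"
  assumes "p \<in> points"
  shows "card (sig_nbhd p) > CARD('a) + 1"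
proof -
  have "card (points - {p}) > 0"
    using assms finite_points card_points[where 'a = 'a] by (simp add: card_Diff_singleton)
  then obtain r where r: "r \<in> points" "r \<noteq> p"
    by (auto simp: card_gt_0_iff)
  have small: "{p} \<in> small_sets" "{p, r} \<in> small_sets"
    using assms r by (auto simp: small_sets_def)
  have "ops_with {p} \<union> ops_with {p, r} \<subseteq> sig_nbhd p"
  proof
    fix y assume "y \<in> ops_with {p} \<union> ops_with {p, r}"
    then have "p \<in> sig_nbhd y"
      unfolding ops_with_def by blast
    then show "y \<in> sig_nbhd p"
      by (simp only: mem_sig_nbhd sig_adj_commute)
  qed
  then have "card (ops_with {p} \<union> ops_with {p, r}) \<le> card (sig_nbhd p)"
    by (intro card_mono) simp_all
  moreover have "ops_with {p} \<inter> ops_with {p, r} = {}"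
    using r by (auto simp: ops_with_def)
  then have "card (ops_with {p} \<union> ops_with {p, r}) = CARD('a) + CARD('a)"
    by (simp add: card_Un_disjoint card_ops_with_small small)
  ultimately show ?thesis
    using card_field_ge_2[where 'a = 'a] by linarith
qed

lemma card_sig_nbhd_op:
  fixes x :: "'a::{field,finite} vertex"
  assumes "x \<in> ops"
  shows "card (sig_nbhd x) \<le> CARD('a) + 1"
  using card_mono[OF finite_points sig_nbhd_op_subset[OF assms]] by (simp add: card_points)

lemma
  fixes f :: "'a::{field,finite} vertex \<Rightarrow> 'a vertex"
  assumes f: "f \<in> carrier sig_aut"
  shows sig_aut_point: "x \<in> points \<Longrightarrow> f x \<in> points"
    and sig_aut_points: "bij_betw f points points"
    and sig_aut_op: "x \<in> ops \<Longrightarrow> f x \<in> ops"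
proof -
  have bij: "bij_betw f sig_verts sig_verts"
    using sig_aut_in_Bij[OF f] by (simp add: Bij_def)
  have inj: "inj_on f points"
    by (rule inj_on_subset[OF bij_betw_imp_inj_on[OF bij]]) (simp add: sig_verts_eq)
  show *: "f x \<in> points" if "x \<in> points" for x
  proof (rule ccontr)
    have x: "x \<in> sig_verts"
      using that by (simp add: sig_verts_eq)
    assume "f x \<notin> points"
    then have "f x \<in> ops"
      using bij_betw_apply[OF bij x] by (simp add: sig_verts_eq)
    then have "card (sig_nbhd (f x)) \<le> CARD('a) + 1"
      by (rule card_sig_nbhd_op)
    moreover have "card (sig_nbhd (f x)) = card (sig_nbhd x)"
      unfolding sig_nbhd_aut[OF f x]
      by (rule card_image, rule inj_on_subset[OF bij_betw_imp_inj_on[OF bij]])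
        (simp add: nbhd_def)
    ultimately show False
      using card_sig_nbhd_point[OF that] by simp
  qed
  then have "f ` points = points"
    using endo_inj_surj[OF finite_points _ inj] by blast
  with inj show **: "bij_betw f points points"
    by (simp add: bij_betw_def)
  show "f x \<in> ops" if "x \<in> ops" for x
  proof (rule ccontr)
    have x: "x \<in> sig_verts"
      using that by (simp add: sig_verts_eq)
    assume "f x \<notin> ops"
    then have "f x \<in> points"
      using bij_betw_apply[OF bij x] by (simp add: sig_verts_eq)
    then have "f x \<in> f ` points"
      by (simp add: bij_betw_imp_surj_on[OF **])
    then obtain y where y: "f x = f y" "y \<in> points"
      by (rule imageE)
    then have "y \<in> sig_verts"
      by (simp add: sig_verts_eq)
    then have "y = x"
      using inj_onD[OF bij_betw_imp_inj_on[OF bij], of x y] x y by simp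
    with \<open>y \<in> points\<close> that show False
      using ops_points_disjoint by blast
  qed
qed

text \<open>
  As the graph is bipartite, it suffices to control the neighbourhoods of the operators.
\<close>
lemma sig_autI:
  assumes bij: "f \<in> Bij sig_verts"
    and points: "\<And>x. x \<in> points \<Longrightarrow> f x \<in> points"
    and ops: "\<And>x. x \<in> ops \<Longrightarrow> f x \<in> ops"
    and nbhd: "\<And>x. x \<in> ops \<Longrightarrow> sig_nbhd (f x) = f ` sig_nbhd x"
  shows "f \<in> carrier sig_aut"
proof -
  have inj: "inj_on f sig_verts"
    using bij by (simp add: Bij_def bij_betw_def)
  have op_point: "sig_adj (f x) (f y) \<longleftrightarrow> sig_adj x y" if "x \<in> ops" "y \<in> points" for x y
  proof -
    have "sig_adj (f x) (f y) \<longleftrightarrow> f y \<in> f ` sig_nbhd x"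
      by (simp only: nbhd[OF that(1), symmetric] mem_sig_nbhd)
    also have "\<dots> \<longleftrightarrow> y \<in> sig_nbhd x"
      by (rule inj_on_image_mem_iff[OF inj]) (use that in \<open>auto simp: sig_verts_eq nbhd_def\<close>)
    finally show ?thesis by (simp add: mem_sig_nbhd)
  qed
  have "sig_adj (f x) (f y) \<longleftrightarrow> sig_adj x y" if xy: "x \<in> sig_verts" "y \<in> sig_verts" for x y
  proof -
    consider "x \<in> ops" "y \<in> points" | "x \<in> points" "y \<in> ops" | "x \<in> ops" "y \<in> ops"
      | "x \<in> points" "y \<in> points"
      using xy unfolding sig_verts_eq by blast
    then show ?thesis
    proof cases
      case 1
      then show ?thesis by (rule op_point)
    next
      case 2
      then show ?thesis
        using op_point[of y x] by (simp add: sig_adj_commute[of "f x"] sig_adj_commute[of x])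
    qed (use ops points sig_adj_bipartite ops_points_disjoint in blast)+
  qed
  with bij show ?thesis
    by (simp add: sig_aut_def mem_graph_aut)
qed

section \<open>Permuting the twin classes\<close>

text \<open>
  The component at \<open>C\<close> of a family of permutations that is given as a pair, one half for \<open>T1\<close>
  and one for \<open>T2\<close>. It allows both kinds of classes to be treated at once.
\<close>
definition class_perm ::
  "('a::field vertex set, 'a vertex set, 'a vertex) kernel_elt \<Rightarrow> 'a vertex set \<Rightarrow> 'a vertex \<Rightarrow> 'a vertex"
where
  "class_perm \<kappa> C = (if C \<in> T1 then fst \<kappa> C else snd \<kappa> C)"

lemma group_twin_perms: "group twin_perms"
  by (simp add: twin_perms_def DirProd_group group_BijGroup)

lemma carrier_twin_perms:
  "\<kappa> \<in> carrier twin_perms \<longleftrightarrow> fst \<kappa> \<in> (\<Pi>\<^sub>E C\<in>T1. Bij C) \<and> snd \<kappa> \<in> (\<Pi>\<^sub>E C\<in>T2. Bij C)"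
  by (cases \<kappa>) (simp add: twin_perms_def)

lemma class_perm_Bij:
  assumes "\<kappa> \<in> carrier twin_perms" "C \<in> T1 \<union> T2"
  shows "class_perm \<kappa> C \<in> Bij C"
  using assms by (auto simp: carrier_twin_perms class_perm_def PiE_iff)

lemma ops_with_in_T1_T2:
  "X \<in> small_sets \<Longrightarrow> ops_with X \<in> T1 \<union> T2" for X :: "'a::{field,finite} vertex set"
  unfolding T1_T2_eq by (rule imageI)

lemma twin_incl_apply:
  "x \<in> sig_verts \<Longrightarrow> twin_incl \<kappa> x =
    (if sig_twins `` {x} \<in> T1 \<union> T2 then class_perm \<kappa> (sig_twins `` {x}) x else x)"
  by (cases \<kappa>) (simp add: twin_incl_def class_perm_def Let_def)

text \<open>
  Neither the twin class of a point nor that of the identity line belongs to \<open>T1\<close> or \<open>T2\<close>.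
\<close>
lemma twin_incl_point [simp]:
  fixes x :: "'a::{field,finite} vertex"
  assumes "x \<in> points"
  shows "twin_incl \<kappa> x = x"
proof -
  have x: "x \<in> sig_verts"
    using assms by (simp add: sig_verts_eq)
  have "sig_twins `` {x} \<notin> T1 \<union> T2"
  proof
    assume "sig_twins `` {x} \<in> T1 \<union> T2"
    then obtain X where "X \<in> small_sets" "sig_twins `` {x} = ops_with X"
      by (rule twin_class_cases)
    moreover have "x \<in> sig_twins `` {x}"
      using x by (simp add: twin_rel_def)
    ultimately show False
      using assms ops_with_small(3) by blast
  qed
  then show ?thesis
    by (simp add: twin_incl_apply x)
qed

lemma twin_incl_id_op [simp]: "twin_incl \<kappa> (id_op :: 'a::{field,finite} vertex) = id_op"
proof -
  have x: "id_op \<in> (sig_verts :: 'a vertex set)"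
    by (simp add: sig_verts_eq id_op_in_ops)
  have "sig_twins `` {id_op :: 'a vertex} \<notin> T1 \<union> T2"
  proof
    assume "sig_twins `` {id_op :: 'a vertex} \<in> T1 \<union> T2"
    then obtain X :: "'a vertex set" where "X \<in> small_sets" "sig_twins `` {id_op} = ops_with X"
      by (rule twin_class_cases)
    moreover have "id_op \<in> sig_twins `` {id_op :: 'a vertex}"
      using x by (simp add: twin_rel_def)
    ultimately show False
      using ops_with_small(4) by blast
  qed
  then show ?thesis
    by (simp add: twin_incl_apply x)
qed

lemma twin_incl_op:
  fixes x :: "'a::{field,finite} vertex"
  assumes "X \<in> small_sets" "x \<in> ops_with X"
  shows "twin_incl \<kappa> x = class_perm \<kappa> (ops_with X) x"
proof -
  have "x \<in> ops" "sig_nbhd x = X"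
    using ops_with_small[OF assms] by auto
  then have "x \<in> sig_verts" "sig_twins `` {x} = ops_with X"
    using twin_class_op by (auto simp: sig_verts_eq)
  then show ?thesis
    using ops_with_in_T1_T2[OF assms(1)] by (simp add: twin_incl_apply)
qed

lemma twin_incl_op_mem:
  fixes x :: "'a::{field,finite} vertex"
  assumes "\<kappa> \<in> carrier twin_perms" "X \<in> small_sets" "x \<in> ops_with X"
  shows "twin_incl \<kappa> x \<in> ops_with X"
  using class_perm_Bij[OF assms(1) ops_with_in_T1_T2[OF assms(2)]] Bij_imp_funcset assms
  by (fastforce simp: twin_incl_op[OF assms(2,3)])

lemma twin_incl_extensional: "twin_incl \<kappa> \<in> extensional sig_verts"
  by (cases \<kappa>) (simp add: twin_incl_def)

lemma twin_incl_op_closed: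
  fixes x :: "'a::{field,finite} vertex"
  assumes \<kappa>: "\<kappa> \<in> carrier twin_perms" and x: "x \<in> ops"
  shows "twin_incl \<kappa> x \<in> ops" "sig_nbhd (twin_incl \<kappa> x) = sig_nbhd x"
proof -
  have "x = id_op \<or> sig_nbhd x \<in> small_sets \<and> x \<in> ops_with (sig_nbhd x)"
    using x sig_nbhd_small by (auto simp: ops_with_def)
  then have "twin_incl \<kappa> x \<in> ops \<and> sig_nbhd (twin_incl \<kappa> x) = sig_nbhd x"
    using twin_incl_op_mem[OF \<kappa>] id_op_in_ops by (auto simp: ops_with_def)
  then show "twin_incl \<kappa> x \<in> ops" "sig_nbhd (twin_incl \<kappa> x) = sig_nbhd x"
    by auto
qed

lemma twin_incl_closed:
  fixes x :: "'a::{field,finite} vertex"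
  assumes "\<kappa> \<in> carrier twin_perms" "x \<in> sig_verts"
  shows "twin_incl \<kappa> x \<in> sig_verts"
  using assms(2) twin_incl_op_closed(1)[OF assms(1)] by (auto simp: sig_verts_eq)

lemma class_perm_mult:
  fixes C :: "'a::{field,finite} vertex set"
  assumes "\<kappa> \<in> carrier twin_perms" "\<kappa>' \<in> carrier twin_perms" "C \<in> T1 \<union> T2"
  shows "class_perm (\<kappa> \<otimes>\<^bsub>twin_perms\<^esub> \<kappa>') C = compose C (class_perm \<kappa> C) (class_perm \<kappa>' C)"
proof -
  obtain k1 k2 k1' k2' where \<kappa>: "\<kappa> = (k1, k2)" "\<kappa>' = (k1', k2')"
    by (metis prod.exhaust)
  consider "C \<in> T1" | "C \<notin> T1" "C \<in> T2"
    using assms(3) by blast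
  then show ?thesis
  proof cases
    case 1
    then have "k1 C \<in> Bij C" "k1' C \<in> Bij C"
      using assms(1,2) by (simp_all add: carrier_twin_perms \<kappa> PiE_iff)
    then show ?thesis
      using 1 by (simp add: twin_perms_def class_perm_def \<kappa> mult_BijGroup)
  next
    case 2
    then have "k2 C \<in> Bij C" "k2' C \<in> Bij C"
      using assms(1,2) by (simp_all add: carrier_twin_perms \<kappa> PiE_iff)
    then show ?thesis
      using 2 by (simp add: twin_perms_def class_perm_def \<kappa> mult_BijGroup)
  qed
qed

lemma twin_incl_mult:
  fixes \<kappa> :: "('a::{field,finite} vertex set, 'a vertex set, 'a vertex) kernel_elt"
  assumes \<kappa>: "\<kappa> \<in> carrier twin_perms" "\<kappa>' \<in> carrier twin_perms"
  shows "twin_incl (\<kappa> \<otimes>\<^bsub>twin_perms\<^esub> \<kappa>') = compose sig_verts (twin_incl \<kappa>) (twin_incl \<kappa>')"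
proof (rule extensionalityI[of _ sig_verts])
  fix x :: "'a vertex" assume x: "x \<in> sig_verts"
  then show "twin_incl (\<kappa> \<otimes>\<^bsub>twin_perms\<^esub> \<kappa>') x = compose sig_verts (twin_incl \<kappa>) (twin_incl \<kappa>') x"
  proof (cases rule: sig_verts_cases)
    case (small X)
    have "twin_incl \<kappa>' x \<in> ops_with X"
      using twin_incl_op_mem[OF \<kappa>(2) small] .
    with small x show ?thesis
      by (simp add: compose_eq twin_incl_op[of X] class_perm_mult[OF \<kappa> ops_with_in_T1_T2])
  qed (use x in \<open>simp_all add: compose_eq\<close>)
qed (simp_all add: twin_incl_extensional)

lemma twin_incl_Bij:
  fixes \<kappa> :: "('a::{field,finite} vertex set, 'a vertex set, 'a vertex) kernel_elt"
  assumes \<kappa>: "\<kappa> \<in> carrier twin_perms"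
  shows "twin_incl \<kappa> \<in> Bij sig_verts"
proof -
  have "inj_on (twin_incl \<kappa>) sig_verts"
  proof (rule inj_onI)
    fix x y :: "'a vertex" assume x: "x \<in> sig_verts" and y: "y \<in> sig_verts"
      and eq: "twin_incl \<kappa> x = twin_incl \<kappa> y"
    from x show "x = y"
    proof (cases rule: sig_verts_cases)
      case (small X)
      have tx: "twin_incl \<kappa> x \<in> ops_with X"
        using twin_incl_op_mem[OF \<kappa> small] .
      from y show ?thesis
      proof (cases rule: sig_verts_cases)
        case (small Y)
        have "twin_incl \<kappa> y \<in> ops_with Y"
          using twin_incl_op_mem[OF \<kappa> small] .
        with tx eq have "X = Y"
          by (simp add: ops_with_def)
        have "inj_on (class_perm \<kappa> (ops_with X)) (ops_with X)"
          using class_perm_Bij[OF \<kappa> ops_with_in_T1_T2[OF \<open>X \<in> small_sets\<close>]]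
          by (simp add: Bij_def bij_betw_def)
        then show ?thesis
          using eq small \<open>x \<in> ops_with X\<close> unfolding \<open>X = Y\<close>
          by (simp add: twin_incl_op[of Y] inj_on_def)
      qed (use tx eq ops_with_small[OF small(1)] in auto)
    next
      case point
      with y eq show ?thesis
      proof (cases rule: sig_verts_cases)
        case (small Y)
        then show ?thesis
          using twin_incl_op_mem[OF \<kappa> small] ops_with_small(3)[OF small(1)] eq point by simp
      qed (use id_op_in_ops ops_points_disjoint in auto)
    next
      case id_op
      with y eq show ?thesis
      proof (cases rule: sig_verts_cases)
        case (small Y)
        have "twin_incl \<kappa> y \<noteq> id_op"
          using ops_with_small(4)[OF small(1) twin_incl_op_mem[OF \<kappa> small]] .
        moreover have "twin_incl \<kappa> x = id_op"
          using id_op by simp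
        ultimately show ?thesis
          using eq by simp
      qed auto
    qed
  qed
  moreover from this have "twin_incl \<kappa> ` sig_verts = sig_verts"
    using twin_incl_closed[OF \<kappa>] by (intro endo_inj_surj) auto
  ultimately show ?thesis
    by (simp add: Bij_def bij_betw_def twin_incl_extensional)
qed

text \<open>
  Moving an operator inside its twin class keeps its neighbourhood, which consists of fixed points.
\<close>
lemma twin_incl_aut:
  fixes \<kappa> :: "('a::{field,finite} vertex set, 'a vertex set, 'a vertex) kernel_elt"
  assumes \<kappa>: "\<kappa> \<in> carrier twin_perms"
  shows "twin_incl \<kappa> \<in> carrier sig_aut"
proof (rule sig_autI)
  fix x :: "'a vertex" assume x: "x \<in> ops"
  have "twin_incl \<kappa> ` sig_nbhd x = id ` sig_nbhd x"
    using sig_nbhd_op_subset[OF x] by (intro image_cong) auto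
  then show "sig_nbhd (twin_incl \<kappa> x) = twin_incl \<kappa> ` sig_nbhd x"
    by (simp add: twin_incl_op_closed(2)[OF \<kappa> x])
qed (simp_all add: twin_incl_Bij[OF \<kappa>] twin_incl_op_closed(1)[OF \<kappa>])

lemma twin_incl_mon:
  "twin_incl \<in> mon twin_perms
    (sig_aut :: ('a::{field,finite} vertex \<Rightarrow> 'a vertex) monoid)"
proof -
  have "inj_on twin_incl (carrier (twin_perms :: 
      ('a vertex set, 'a vertex set, 'a vertex) kernel_elt monoid))"
  proof (rule inj_onI)
    fix \<kappa> \<kappa>' :: "('a vertex set, 'a vertex set, 'a vertex) kernel_elt"
    assume \<kappa>: "\<kappa> \<in> carrier twin_perms" "\<kappa>' \<in> carrier twin_perms" 
      and eq: "twin_incl \<kappa> = twin_incl \<kappa>'"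
    have cp: "class_perm \<kappa> C = class_perm \<kappa>' C" if C: "C \<in> T1 \<union> T2" for C
    proof (rule extensionalityI[of _ C])
      show "class_perm \<kappa> C \<in> extensional C" "class_perm \<kappa>' C \<in> extensional C"
        using class_perm_Bij[OF \<kappa>(1) C] class_perm_Bij[OF \<kappa>(2) C] by (simp_all add: Bij_def)
      fix x assume "x \<in> C"
      moreover obtain X where "X \<in> small_sets" "C = ops_with X"
        using C by (rule twin_class_cases)
      ultimately show "class_perm \<kappa> C x = class_perm \<kappa>' C x"
        using eq by (simp flip: twin_incl_op)
    qed
    have "fst \<kappa> = fst \<kappa>'"
    proof (rule PiE_ext)
      show "fst \<kappa> \<in> (\<Pi>\<^sub>E C\<in>T1. Bij C)" "fst \<kappa>' \<in> (\<Pi>\<^sub>E C\<in>T1. Bij C)"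
        using \<kappa> by (simp_all add: carrier_twin_perms)
      show "fst \<kappa> C = fst \<kappa>' C" if "C \<in> T1" for C
        using cp[of C] that by (simp add: class_perm_def)
    qed
    moreover have "snd \<kappa> = snd \<kappa>'"
    proof (rule PiE_ext)
      show "snd \<kappa> \<in> (\<Pi>\<^sub>E C\<in>T2. Bij C)" "snd \<kappa>' \<in> (\<Pi>\<^sub>E C\<in>T2. Bij C)"
        using \<kappa> by (simp_all add: carrier_twin_perms)
      show "snd \<kappa> C = snd \<kappa>' C" if "C \<in> T2" for C
      proof -
        have "C \<notin> T1"
          using that T1_T2_disjoint by blast
        then show ?thesis
          using cp[of C] that by (simp add: class_perm_def)
      qed
    qed
    ultimately show "\<kappa> = \<kappa>'"
      by (rule prod_eqI)
  qed
  then show ?thesis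
    by (simp add: mon_def hom_def Pi_def twin_incl_aut twin_incl_mult sig_aut_mult)
qed


section \<open>Restriction to the points\<close>

lemma point_restr_Bij:
  fixes f :: "'a::{field,finite} vertex \<Rightarrow> 'a vertex"
  assumes "f \<in> carrier sig_aut"
  shows "point_restr f \<in> Bij points"
  using sig_aut_points[OF assms] by (simp add: point_restr_def Bij_def)

lemma point_restr_hom:
  "point_restr \<in> hom (sig_aut :: ('a::{field,finite} vertex \<Rightarrow> 'a vertex) monoid) (BijGroup points)"
proof (rule homI)
  fix f g :: "'a vertex \<Rightarrow> 'a vertex"
  assume f: "f \<in> carrier sig_aut" and g: "g \<in> carrier sig_aut"
  have "point_restr (compose sig_verts f g) = compose points (point_restr f) (point_restr g)"
    using sig_aut_point[OF g]
    by (intro extensionalityI[of _ points]) (auto simp: point_restr_def compose_eq sig_verts_eq)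
  then show "point_restr (f \<otimes>\<^bsub>sig_aut\<^esub> g) = point_restr f \<otimes>\<^bsub>BijGroup points\<^esub> point_restr g"
    using f g by (simp add: sig_aut_mult mult_BijGroup point_restr_Bij)
qed (simp add: point_restr_Bij)

text \<open>
  If \<open>f\<close> fixes all points, then the neighbourhood of \<open>f x\<close> is the image of that of \<open>x\<close>, hence
  the same set. So \<open>f\<close> maps each class to itself and is determined by its restrictions to the
  classes. The identity line is fixed because it is the only operator with more than two neighbours.
\<close>
lemma twin_incl_kernel:
  "twin_incl ` carrier twin_perms =
    kernel (sig_aut :: ('a::{field,finite} vertex \<Rightarrow> 'a vertex) monoid) (BijGroup points) point_restr"
proof (intro equalityI subsetI)
  fix f :: "'a vertex \<Rightarrow> 'a vertex" assume "f \<in> twin_incl ` carrier twin_perms"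
  then obtain \<kappa> where \<kappa>: "\<kappa> \<in> carrier twin_perms" "f = twin_incl \<kappa>" by blast
  then show "f \<in> kernel sig_aut (BijGroup points) point_restr"
    by (auto simp: kernel_def one_BijGroup point_restr_def twin_incl_aut)
next
  fix f :: "'a vertex \<Rightarrow> 'a vertex" assume "f \<in> kernel sig_aut (BijGroup points) point_restr"
  then have f: "f \<in> carrier sig_aut" and "restrict f points = (\<lambda>x\<in>points. x)"
    by (auto simp: kernel_def one_BijGroup point_restr_def)
  then have fix_points: "f x = x" if "x \<in> points" for x
    using that by (metis restrict_apply')
  have nb: "f x \<in> ops" "sig_nbhd (f x) = sig_nbhd x" if "x \<in> ops" for x
  proof -
    have "f ` sig_nbhd x = id ` sig_nbhd x"
      using sig_nbhd_op_subset[OF that] fix_points by (intro image_cong) auto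
    then show "sig_nbhd (f x) = sig_nbhd x"
      using sig_nbhd_aut[OF f, of x] that by (simp add: sig_verts_eq)
  qed (rule sig_aut_op[OF f that])
  have inj: "inj_on f sig_verts"
    using sig_aut_in_Bij[OF f] by (simp add: Bij_def bij_betw_def)
  have Bij: "restrict f C \<in> Bij C" if C: "C \<in> T1 \<union> T2" for C
  proof -
    obtain X where X: "X \<in> small_sets" "C = ops_with X"
      using C by (rule twin_class_cases)
    have "inj_on f C"
      by (rule inj_on_subset[OF inj]) (auto simp: X ops_with_def sig_verts_eq)
    moreover have "f ` C \<subseteq> C"
      using nb by (auto simp: X ops_with_def)
    ultimately show ?thesis
      by (simp add: Bij_def bij_betw_def endo_inj_surj)
  qed
  define \<kappa> where "\<kappa> = (\<lambda>C\<in>T1. restrict f C, \<lambda>C\<in>T2. restrict f C)"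
  have \<kappa>: "\<kappa> \<in> carrier twin_perms"
    using Bij by (simp add: carrier_twin_perms \<kappa>_def)
  have cp: "class_perm \<kappa> C = restrict f C" if "C \<in> T1 \<union> T2" for C
    using that by (auto simp: class_perm_def \<kappa>_def)
  have "f = twin_incl \<kappa>"
  proof (rule extensionalityI[of _ sig_verts])
    show "f \<in> extensional sig_verts"
      using sig_aut_in_Bij[OF f] by (simp add: Bij_def)
    fix x :: "'a vertex" assume x: "x \<in> sig_verts"
    then show "f x = twin_incl \<kappa> x"
    proof (cases rule: sig_verts_cases)
      case point
      then show ?thesis by (simp add: fix_points)
    next
      case id_op
      have "sig_nbhd (f id_op) \<notin> small_sets"
        using nb[OF id_op_in_ops] points_not_small by (simp add: sig_nbhd_id_op)
      then have "f id_op = id_op"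
        using sig_nbhd_small nb(1)[OF id_op_in_ops] by blast
      then show ?thesis by (simp add: id_op)
    next
      case (small X)
      then show ?thesis
        by (simp add: twin_incl_op[of X] cp[OF ops_with_in_T1_T2])
    qed
  qed (rule twin_incl_extensional)
  then show "f \<in> twin_incl ` carrier twin_perms"
    using \<kappa> by blast
qed


section \<open>Extending permutations of the points\<close>

lemma labeling_exists: "\<exists>lab :: 'a::{field,finite} vertex set \<Rightarrow> nat \<Rightarrow> 'a vertex. labeling lab"
proof -
  have "\<exists>h. X \<in> small_sets \<longrightarrow> bij_betw h {1..CARD('a)} (ops_with X)" for X :: "'a vertex set"
    using ex_bij_betw_nat_finite_1[of "ops_with X"] card_ops_with_small by fastforce
  then obtain lab :: "'a vertex set \<Rightarrow> nat \<Rightarrow> 'a vertex" 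
    where "\<forall>X. X \<in> small_sets \<longrightarrow> bij_betw (lab X) {1..CARD('a)} (ops_with X)"
    by metis
  then show ?thesis
    by (auto simp: labeling_def small_sets_def)
qed

lemma labeling_bij:
  fixes lab :: "'a::{field,finite} vertex set \<Rightarrow> nat \<Rightarrow> 'a vertex"
  shows "labeling lab \<Longrightarrow> X \<in> small_sets \<Longrightarrow> bij_betw (lab X) {1..CARD('a)} (ops_with X)"
  by (simp add: labeling_def small_sets_def)

context
  fixes lab :: "'a::{field,finite} vertex set \<Rightarrow> nat \<Rightarrow> 'a vertex"
  assumes lab: "labeling lab"
begin

lemma lab_cases:
  assumes "x \<in> sig_verts"
  obtains (point) "x \<in> points"
    | (id_op) "x = id_op"
    | (label) X i where "X \<in> small_sets" "i \<in> {1..CARD('a)}" "x = lab X i"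
  using assms
proof (cases rule: sig_verts_cases)
  case (small X)
  then have "x \<in> lab X ` {1..CARD('a)}"
    using labeling_bij[OF lab small(1)] by (simp add: bij_betw_def)
  with small(1) that(3) show ?thesis by blast
qed (use that in blast)+

lemma lab_in_ops_with:
  assumes "X \<in> small_sets" "i \<in> {1..CARD('a)}"
  shows "lab X i \<in> ops_with X"
  using labeling_bij[OF lab assms(1)] assms(2) by (rule bij_betw_apply)

lemma hat_point: "x \<in> points \<Longrightarrow> hat lab \<sigma> x = \<sigma> x"
  by (simp add: hat_def sig_verts_eq)

lemma hat_id_op: "hat lab \<sigma> id_op = id_op"
  using id_op_in_ops ops_points_disjoint by (auto simp: hat_def sig_verts_eq)

lemma hat_lab:
  assumes X: "X \<in> small_sets" and i: "i \<in> {1..CARD('a)}"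
  shows "hat lab \<sigma> (lab X i) = lab (\<sigma> ` X) i"
proof -
  note x = ops_with_small[OF X lab_in_ops_with[OF X i]]
  have "inv_into {1..CARD('a)} (lab X) (lab X i) = i"
    using labeling_bij[OF lab X] i by (simp add: bij_betw_def)
  then show ?thesis
    using x by (simp add: hat_def sig_verts_eq)
qed

lemma image_small:
  assumes "\<sigma> \<in> Bij points" "X \<in> small_sets"
  shows "\<sigma> ` X \<in> small_sets"
proof -
  have "inj_on \<sigma> X" "\<sigma> ` X \<subseteq> points"
    using assms by (auto simp: Bij_def bij_betw_def small_sets_def intro: inj_on_subset)
  then show ?thesis
    using assms(2) by (simp add: small_sets_def card_image)
qed

lemma hat_closed:
  assumes \<sigma>: "\<sigma> \<in> Bij points" and x: "x \<in> sig_verts"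
  shows "hat lab \<sigma> x \<in> sig_verts"
  using x
proof (cases rule: lab_cases)
  case point
  then show ?thesis
    using Bij_imp_funcset[OF \<sigma>] by (auto simp: hat_point sig_verts_eq)
next
  case id_op
  then show ?thesis
    using x by (simp add: hat_id_op)
next
  case (label X i)
  then show ?thesis
    using lab_in_ops_with[OF image_small[OF \<sigma>], of X i]
    by (auto simp: hat_lab sig_verts_eq ops_with_def)
qed

lemma hat_extensional: "hat lab \<sigma> \<in> extensional sig_verts"
  by (simp add: hat_def)

text \<open>
  On labels, \<open>hat lab \<sigma>\<close> replaces \<open>X\<close> by \<open>\<sigma> ` X\<close> and keeps \<open>i\<close> (\<open>hat_lab\<close>).
  The image of \<open>X\<close> under a composition is the iterated image, and the
  label is the same on both sides. Bijectivity of \<open>hat lab \<sigma>\<close> follows, by composing with the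
  lift of the inverse permutation.
\<close>
lemma hat_compose:
  assumes \<sigma>: "\<sigma> \<in> Bij points" and \<tau>: "\<tau> \<in> Bij points"
  shows "hat lab (compose points \<sigma> \<tau>) = compose sig_verts (hat lab \<sigma>) (hat lab \<tau>)"
proof (rule extensionalityI[of _ sig_verts])
  fix x :: "'a vertex" assume x: "x \<in> sig_verts"
  then show "hat lab (compose points \<sigma> \<tau>) x = compose sig_verts (hat lab \<sigma>) (hat lab \<tau>) x"
  proof (cases rule: lab_cases)
    case point
    then have "\<tau> x \<in> points"
      using Bij_imp_funcset[OF \<tau>] by auto
    with point x show ?thesis
      by (simp add: compose_eq hat_point)
  next
    case id_op
    with x show ?thesis
      by (simp add: compose_eq hat_id_op)
  next
    case (label X i)
    then have "compose points \<sigma> \<tau> ` X = \<sigma> ` \<tau> ` X"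
      by (auto simp: small_sets_def compose_def image_image intro!: image_cong)
    with label x image_small[OF \<tau> label(1)] show ?thesis
      by (simp add: compose_eq hat_lab)
  qed
qed (simp_all add: hat_extensional)

lemma hat_one: "hat lab (\<lambda>x\<in>points. x) = (\<lambda>x\<in>sig_verts. x)"
proof (rule extensionalityI[of _ sig_verts])
  fix x :: "'a vertex" assume x: "x \<in> sig_verts"
  then show "hat lab (\<lambda>x\<in>points. x) x = (\<lambda>x\<in>sig_verts. x) x"
  proof (cases rule: lab_cases)
    case (label X i)
    then have "(\<lambda>x\<in>points. x) ` X = X"
      by (auto simp: small_sets_def image_iff)
    with label x show ?thesis
      by (simp add: hat_lab)
  qed (use x in \<open>auto simp: hat_point hat_id_op\<close>)
qed (simp_all add: hat_extensional)

lemma hat_Bij: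
  assumes \<sigma>: "\<sigma> \<in> Bij points"
  shows "hat lab \<sigma> \<in> Bij sig_verts"
proof -
  define \<tau> where "\<tau> = (\<lambda>x\<in>points. inv_into points \<sigma> x)"
  have \<tau>: "\<tau> \<in> Bij points" "compose points \<tau> \<sigma> = (\<lambda>x\<in>points. x)"
    using restrict_inv_into_Bij[OF \<sigma>] Bij_compose_restrict_eq[OF \<sigma>] by (simp_all add: \<tau>_def)
  have "inj_on (hat lab \<sigma>) sig_verts"
  proof (rule inj_on_inverseI)
    fix x :: "'a vertex" assume "x \<in> sig_verts"
    then show "hat lab \<tau> (hat lab \<sigma> x) = x"
      using fun_cong[OF hat_compose[OF \<tau>(1) \<sigma>], of x] by (simp add: \<tau>(2) hat_one compose_eq)
  qed
  moreover from this have "hat lab \<sigma> ` sig_verts = sig_verts"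
    using hat_closed[OF \<sigma>] by (intro endo_inj_surj) auto
  ultimately show ?thesis
    by (simp add: Bij_def bij_betw_def hat_extensional)
qed

lemma hat_aut:
  assumes \<sigma>: "\<sigma> \<in> Bij points"
  shows "hat lab \<sigma> \<in> carrier sig_aut"
proof (rule sig_autI)
  show "hat lab \<sigma> \<in> Bij sig_verts"
    using \<sigma> by (rule hat_Bij)
  show "hat lab \<sigma> x \<in> points" if "x \<in> points" for x
    using that Bij_imp_funcset[OF \<sigma>] by (auto simp: hat_point)
  fix x :: "'a vertex" assume x: "x \<in> ops"
  have im: "hat lab \<sigma> ` X = \<sigma> ` X" if "X \<subseteq> points" for X
    using that by (intro image_cong) (auto simp: hat_point)
  from x have "x \<in> sig_verts"
    by (simp add: sig_verts_eq)
  then have "hat lab \<sigma> x \<in> ops \<and> sig_nbhd (hat lab \<sigma> x) = hat lab \<sigma> ` sig_nbhd x"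
  proof (cases rule: lab_cases)
    case point
    with x ops_points_disjoint show ?thesis by blast
  next
    case id_op
    have "\<sigma> ` points = points"
      using \<sigma> by (simp add: Bij_def bij_betw_def)
    then show ?thesis
      by (simp add: id_op hat_id_op id_op_in_ops sig_nbhd_id_op im)
  next
    case (label X i)
    have "X \<subseteq> points"
      using label by (simp add: small_sets_def)
    then show ?thesis
      using lab_in_ops_with[OF image_small[OF \<sigma>], of X i] lab_in_ops_with[of X i] label
      by (simp add: hat_lab ops_with_def im)
  qed
  then show "hat lab \<sigma> x \<in> ops" "sig_nbhd (hat lab \<sigma> x) = hat lab \<sigma> ` sig_nbhd x"
    by auto
qed

lemma hat_hom: "hat lab \<in> hom (BijGroup points) sig_aut"
  by (simp add: hom_def Pi_def hat_aut mult_BijGroup hat_compose sig_aut_mult)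

lemma point_restr_hat:
  assumes "\<sigma> \<in> Bij points"
  shows "point_restr (hat lab \<sigma>) = \<sigma>"
  using Bij_imp_extensional[OF assms]
  by (intro extensionalityI[of _ points]) (auto simp: point_restr_def hat_point)

end

lemma sig_short_exact:
  "short_exact twin_perms (sig_aut :: ('a::{field,finite} vertex \<Rightarrow> 'a vertex) monoid)
    (BijGroup points) twin_incl point_restr"
proof -
  obtain lab :: "'a vertex set \<Rightarrow> nat \<Rightarrow> 'a vertex" where lab: "labeling lab"
    using labeling_exists by blast
  have "point_restr ` carrier sig_aut = Bij (points :: 'a vertex set)"
  proof (intro equalityI subsetI)
    fix \<sigma> :: "'a vertex \<Rightarrow> 'a vertex" assume "\<sigma> \<in> Bij points"
    then show "\<sigma> \<in> point_restr ` carrier sig_aut"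
      using point_restr_hat[OF lab] hat_aut[OF lab] by (metis image_eqI)
  qed (auto simp: point_restr_Bij)
  then show ?thesis
    by (simp add: short_exact_def group_twin_perms group_sig_aut group_BijGroup twin_incl_mon
        twin_incl_kernel epi_def point_restr_hom)
qed

lemma sig_splits:
  "splits (sig_aut :: ('a::{field,finite} vertex \<Rightarrow> 'a vertex) monoid) (BijGroup points) point_restr"
proof -
  obtain lab :: "'a vertex set \<Rightarrow> nat \<Rightarrow> 'a vertex" where lab: "labeling lab"
    using labeling_exists by blast
  then show ?thesis
    unfolding splits_def using hat_hom[OF lab] point_restr_hat[OF lab] by auto
qed

section \<open>Semidirect products from split extensions\<close>

text \<open>
  Instead of a section of \<open>p\<close>, a homomorphism \<open>s\<close> is given whose composition with \<open>p\<close> is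
  bijective. In this way the acting group \<open>H\<close> may be a copy of the quotient \<open>P\<close>, such as the
  symmetric group on \<open>{1..q + 1}\<close> in place of that of the points.
\<close>

context
  fixes K :: "('k, 'x) monoid_scheme" and G :: "('g, 'y) monoid_scheme"
    and H :: "('h, 'z) monoid_scheme" and P :: "('p, 'w) monoid_scheme"
    and j :: "'k \<Rightarrow> 'g" and p :: "'g \<Rightarrow> 'p" and s :: "'h \<Rightarrow> 'g"
  assumes K: "group K" and G: "group G" and H: "group H" and P: "group P"
    and j: "j \<in> mon K G" and p: "p \<in> hom G P" and s: "s \<in> hom H G"
    and exact: "j ` carrier K = kernel G P p"
    and ps: "bij_betw (p \<circ> s) (carrier H) (carrier P)"
begin

interpretation K: group K by (rule K)
interpretation G: group G by (rule G)
interpretation H: group H by (rule H)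
interpretation P: group P by (rule P)
interpretation j: group_hom K G j
  using j by unfold_locales (simp add: mon_def)
interpretation p: group_hom G P p
  using p by unfold_locales
interpretation s: group_hom H G s
  using s by unfold_locales

lemma j_inj: "k \<in> carrier K \<Longrightarrow> k' \<in> carrier K \<Longrightarrow> j k = j k' \<longleftrightarrow> k = k'"
  using j by (auto simp: mon_def inj_on_def)

lemma p_j: "k \<in> carrier K \<Longrightarrow> p (j k) = \<one>\<^bsub>P\<^esub>"
  using exact by (auto simp: kernel_def)

text \<open>
  The image of \<open>j\<close> is a kernel and hence normal, so the conjugate has a preimage under \<open>j\<close>. The
  laws for the action below then follow from those for conjugation in \<open>G\<close>, as \<open>j\<close> is injective.
\<close>
lemma
  assumes h: "h \<in> carrier H" and k: "k \<in> carrier K"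
  shows conj_action_eq: "j (conj_action K G j s h k) = s h \<otimes>\<^bsub>G\<^esub> j k \<otimes>\<^bsub>G\<^esub> inv\<^bsub>G\<^esub> (s h)"
    and conj_action_closed: "conj_action K G j s h k \<in> carrier K"
proof -
  have "j k \<in> kernel G P p"
    using k exact by blast
  then have "s h \<otimes>\<^bsub>G\<^esub> j k \<otimes>\<^bsub>G\<^esub> inv\<^bsub>G\<^esub> (s h) \<in> j ` carrier K"
    unfolding exact using h by (intro normal.inv_op_closed2[OF p.normal_kernel]) auto
  then show "j (conj_action K G j s h k) = s h \<otimes>\<^bsub>G\<^esub> j k \<otimes>\<^bsub>G\<^esub> inv\<^bsub>G\<^esub> (s h)"
    "conj_action K G j s h k \<in> carrier K"
    using k by (auto simp: conj_action_def f_inv_into_f inv_into_into)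
qed

lemma conj_action_hom:
  assumes h: "h \<in> carrier H"
  shows "conj_action K G j s h \<in> hom K K"
proof (rule homI)
  fix k k' assume k: "k \<in> carrier K" "k' \<in> carrier K"
  have "j (conj_action K G j s h (k \<otimes>\<^bsub>K\<^esub> k')) =
      j (conj_action K G j s h k \<otimes>\<^bsub>K\<^esub> conj_action K G j s h k')"
    using h k by (simp add: conj_action_eq conj_action_closed G.m_assoc G.inv_solve_left)
  then show "conj_action K G j s h (k \<otimes>\<^bsub>K\<^esub> k') =
      conj_action K G j s h k \<otimes>\<^bsub>K\<^esub> conj_action K G j s h k'"
    using h k by (subst (asm) j_inj) (simp_all add: conj_action_closed)
qed (simp add: h conj_action_closed)

lemma conj_action_mult:
  assumes h: "h \<in> carrier H" "h' \<in> carrier H" and k: "k \<in> carrier K"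
  shows "conj_action K G j s (h \<otimes>\<^bsub>H\<^esub> h') k = conj_action K G j s h (conj_action K G j s h' k)"
proof -
  have "j (conj_action K G j s (h \<otimes>\<^bsub>H\<^esub> h') k) = j (conj_action K G j s h (conj_action K G j s h' k))"
    using h k by (simp add: conj_action_eq conj_action_closed G.m_assoc G.inv_mult_group)
  then show ?thesis
    using h k by (simp add: j_inj conj_action_closed)
qed

lemma conj_action_one:
  assumes k: "k \<in> carrier K"
  shows "conj_action K G j s \<one>\<^bsub>H\<^esub> k = k"
proof -
  have "j (conj_action K G j s \<one>\<^bsub>H\<^esub> k) = j k"
    using k by (simp add: conj_action_eq)
  then show ?thesis
    using k by (simp add: j_inj conj_action_closed)
qed

lemma conj_action_auto:
  assumes h: "h \<in> carrier H"
  shows "conj_action K G j s h \<in> auto K"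
proof -
  have "bij_betw (conj_action K G j s h) (carrier K) (carrier K)"
    using h by (intro bij_betw_byWitness[where f' = "conj_action K G j s (inv\<^bsub>H\<^esub> h)"])
      (auto simp: conj_action_closed conj_action_one simp flip: conj_action_mult)
  then show ?thesis
    by (simp add: auto_def Bij_def conj_action_hom[OF h]) (simp add: conj_action_def)
qed

lemma conj_action_in_hom_AutoGroup: "conj_action K G j s \<in> hom H (AutoGroup K)"
proof (rule homI)
  fix h h' assume h: "h \<in> carrier H" "h' \<in> carrier H"
  have "conj_action K G j s (h \<otimes>\<^bsub>H\<^esub> h') =
      compose (carrier K) (conj_action K G j s h) (conj_action K G j s h')"
    using conj_action_mult[OF h]
    by (intro extensionalityI[of _ "carrier K"]) (simp_all add: conj_action_def compose_def)
  then show "conj_action K G j s (h \<otimes>\<^bsub>H\<^esub> h') =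
      conj_action K G j s h \<otimes>\<^bsub>AutoGroup K\<^esub> conj_action K G j s h'"
    using conj_action_auto[OF h(1)] conj_action_auto[OF h(2)]
    by (simp add: AutoGroup_def mult_BijGroup auto_def)
qed (simp add: AutoGroup_def conj_action_auto)

text \<open>
  Every element of \<open>G\<close> is uniquely \<open>j k \<otimes> s h\<close>: the image under \<open>p\<close> determines \<open>h\<close>, and the
  quotient by \<open>s h\<close> lies in the kernel of \<open>p\<close>, which is the image of \<open>j\<close>.
\<close>
lemma semidirect_iso: "G \<cong> semidirect K (conj_action K G j s) H"
proof -
  let ?S = "semidirect K (conj_action K G j s) H"
  define f where "f = (\<lambda>(k, h). j k \<otimes>\<^bsub>G\<^esub> s h)"
  have carr: "carrier ?S = carrier K \<times> carrier H"
    by (simp add: semidirect_def)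
  have closed: "a \<otimes>\<^bsub>?S\<^esub> b \<in> carrier ?S" if "a \<in> carrier ?S" "b \<in> carrier ?S" for a b
    using that by (auto simp: semidirect_def conj_action_closed)
  have cancel: "inv\<^bsub>G\<^esub> x \<otimes>\<^bsub>G\<^esub> (x \<otimes>\<^bsub>G\<^esub> y) = y" if "x \<in> carrier G" "y \<in> carrier G" for x y
    using that by (simp flip: G.m_assoc)
  have mult: "f (a \<otimes>\<^bsub>?S\<^esub> b) = f a \<otimes>\<^bsub>G\<^esub> f b" if "a \<in> carrier ?S" "b \<in> carrier ?S" for a b
    using that by (auto simp: semidirect_def f_def conj_action_eq conj_action_closed G.m_assoc cancel)
  have inj: "inj_on f (carrier ?S)"
  proof (rule inj_onI, clarsimp simp: carr f_def)
    fix k h k' h'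
    assume *: "k \<in> carrier K" "h \<in> carrier H" "k' \<in> carrier K" "h' \<in> carrier H"
      and eq: "j k \<otimes>\<^bsub>G\<^esub> s h = j k' \<otimes>\<^bsub>G\<^esub> s h'"
    have "p (j k \<otimes>\<^bsub>G\<^esub> s h) = p (s h)" "p (j k' \<otimes>\<^bsub>G\<^esub> s h') = p (s h')"
      using * by (simp_all add: p_j)
    then have "h = h'"
      using ps * eq by (auto simp: bij_betw_def inj_on_def)
    with * eq show "k = k' \<and> h = h'"
      by (simp add: j_inj)
  qed
  have surj: "f ` carrier ?S = carrier G"
  proof (intro equalityI subsetI)
    fix g assume g: "g \<in> carrier G"
    then have "p g \<in> (p \<circ> s) ` carrier H"
      using bij_betw_imp_surj_on[OF ps] by simp
    then obtain h where h: "h \<in> carrier H" "p g = p (s h)"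
      by auto
    then have "g \<otimes>\<^bsub>G\<^esub> inv\<^bsub>G\<^esub> (s h) \<in> j ` carrier K"
      using g unfolding exact by (simp add: kernel_def)
    then obtain k where k: "k \<in> carrier K" "g \<otimes>\<^bsub>G\<^esub> inv\<^bsub>G\<^esub> (s h) = j k"
      by blast
    then have "f (k, h) = g"
      using g h by (simp add: f_def G.m_assoc flip: k(2))
    then show "g \<in> f ` carrier ?S"
      using k h carr by (intro image_eqI[of _ _ "(k, h)"]) auto
  qed (auto simp: carr f_def)
  have "inv_into (carrier ?S) f \<in> hom G ?S"
  proof (rule homI)
    fix x y assume x: "x \<in> carrier G" and y: "y \<in> carrier G"
    from x obtain a where a: "x = f a" "a \<in> carrier ?S"
      unfolding surj[symmetric] by (rule imageE)
    from y obtain b where b: "y = f b" "b \<in> carrier ?S"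
      unfolding surj[symmetric] by (rule imageE)
    then show "inv_into (carrier ?S) f (x \<otimes>\<^bsub>G\<^esub> y) =
        inv_into (carrier ?S) f x \<otimes>\<^bsub>?S\<^esub> inv_into (carrier ?S) f y"
      using a b closed[of a b] inv_into_f_f[OF inj] by (simp flip: mult)
  qed (simp add: inv_into_into surj)
  moreover have "bij_betw (inv_into (carrier ?S) f) (carrier G) (carrier ?S)"
    using inj surj by (intro bij_betw_inv_into) (simp add: bij_betw_def)
  ultimately show ?thesis
    by (auto simp: is_iso_def iso_def)
qed

end


section \<open>Powers of symmetric groups\<close>

lemma perm_via_nth:
  assumes "bij_betw b {1..m} S" "i \<in> {1..m}"
  shows "perm_via b m S \<pi> (b i) = b (\<pi> i)"
  using assms by (auto simp: perm_via_def bij_betw_def inv_into_f_f)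

text \<open>
  The preimage of a bijection of \<open>S\<close> has to be extended by the identity outside \<open>{1..m}\<close>, because
  the elements of \<open>sym_group m\<close> are permutations of all natural numbers, whereas those of
  \<open>BijGroup S\<close> are undefined outside \<open>S\<close>.
\<close>
lemma perm_via_iso:
  assumes b: "bij_betw b {1..m} S"
  shows "perm_via b m S \<in> iso (sym_group m) (BijGroup S)"
proof -
  have inj_b: "inj_on b {1..m}" and S: "S = b ` {1..m}"
    using b by (auto simp: bij_betw_def)
  have perm_mem: "\<pi> i \<in> {1..m}" if "\<pi> \<in> carrier (sym_group m)" "i \<in> {1..m}" for \<pi> i
    using that by (simp add: sym_group_carrier permutes_in_image del: atLeastAtMost_iff)
  have Bij: "perm_via b m S \<pi> \<in> Bij S" if \<pi>: "\<pi> permutes {1..m}" for \<pi>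
  proof -
    have "bij_betw (b \<circ> \<pi> \<circ> inv_into {1..m} b) S S"
      by (intro bij_betw_trans[OF bij_betw_trans[OF bij_betw_inv_into[OF b] permutes_imp_bij[OF \<pi>]] b,
          folded comp_assoc, simplified comp_assoc[symmetric]])
    then show ?thesis
      by (simp add: Bij_def perm_via_def comp_def)
  qed
  have "perm_via b m S \<in> hom (sym_group m) (BijGroup S)"
  proof (rule homI)
    fix \<pi> \<rho> assume *: "\<pi> \<in> carrier (sym_group m)" "\<rho> \<in> carrier (sym_group m)"
    have "perm_via b m S (\<pi> \<circ> \<rho>) = compose S (perm_via b m S \<pi>) (perm_via b m S \<rho>)"
    proof (rule extensionalityI[of _ S])
      fix x assume "x \<in> S"
      then obtain i where i: "i \<in> {1..m}" "x = b i"
        using S by blast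
      moreover have "\<rho> i \<in> {1..m}"
        using *(2) i(1) by (rule perm_mem)
      ultimately show "perm_via b m S (\<pi> \<circ> \<rho>) x = compose S (perm_via b m S \<pi>) (perm_via b m S \<rho>) x"
        using \<open>x \<in> S\<close> by (simp add: compose_eq perm_via_nth[OF b])
    qed (simp_all add: perm_via_def)
    then show "perm_via b m S (\<pi> \<otimes>\<^bsub>sym_group m\<^esub> \<rho>) =
        perm_via b m S \<pi> \<otimes>\<^bsub>BijGroup S\<^esub> perm_via b m S \<rho>"
      using * by (simp add: sym_group_def mult_BijGroup Bij)
  qed (simp add: sym_group_carrier Bij)
  moreover have "inj_on (perm_via b m S) (carrier (sym_group m))"
  proof (rule inj_onI)
    fix \<pi> \<rho> assume *: "\<pi> \<in> carrier (sym_group m)" "\<rho> \<in> carrier (sym_group m)"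
      and eq: "perm_via b m S \<pi> = perm_via b m S \<rho>"
    show "\<pi> = \<rho>"
    proof
      fix i
      show "\<pi> i = \<rho> i"
      proof (cases "i \<in> {1..m}")
        case True
        then have "b (\<pi> i) = b (\<rho> i)"
          using fun_cong[OF eq, of "b i"] by (simp only: perm_via_nth[OF b])
        moreover have "\<pi> i \<in> {1..m}" "\<rho> i \<in> {1..m}"
          using * True by (simp_all only: perm_mem)
        ultimately show ?thesis
          by (rule inj_onD[OF inj_b])
      next
        case False
        then show ?thesis
          using * by (simp add: sym_group_carrier permutes_not_in)
      qed
    qed
  qed
  moreover have "Bij S \<subseteq> perm_via b m S ` carrier (sym_group m)"
  proof
    fix g assume g: "g \<in> Bij S"
    define \<pi> where "\<pi> i = (if i \<in> {1..m} then inv_into {1..m} b (g (b i)) else i)" for i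
    have gb: "bij_betw g S S"
      using g by (simp add: Bij_def)
    have "bij_betw (\<lambda>i. inv_into {1..m} b (g (b i))) {1..m} {1..m}"
      using bij_betw_trans[OF bij_betw_trans[OF b gb] bij_betw_inv_into[OF b]]
      by (simp add: comp_def)
    then have "bij_betw \<pi> {1..m} {1..m}"
      by (rule bij_betw_cong[THEN iffD1, rotated]) (simp add: \<pi>_def)
    then have \<pi>: "\<pi> \<in> carrier (sym_group m)"
      unfolding sym_group_carrier by (rule bij_imp_permutes) (auto simp: \<pi>_def)
    have "perm_via b m S \<pi> = g"
    proof (rule extensionalityI[of _ S])
      show "g \<in> extensional S"
        using g by (simp add: Bij_def)
      fix x assume "x \<in> S"
      then obtain i where i: "i \<in> {1..m}" "x = b i"
        using S by blast
      have "g x \<in> b ` {1..m}"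
        using \<open>x \<in> S\<close> gb S by (metis bij_betw_apply)
      then have "b (\<pi> i) = g x"
        using i by (simp add: \<pi>_def f_inv_into_f)
      then show "perm_via b m S \<pi> x = g x"
        using i by (simp add: perm_via_nth[OF b])
    qed (simp add: perm_via_def)
    then show "g \<in> perm_via b m S ` carrier (sym_group m)"
      using \<pi> by blast
  qed
  ultimately show ?thesis
    by (auto simp: iso_def bij_betw_def hom_def)
qed

lemma product_group_iso:
  assumes \<phi>: "\<And>i. i \<in> I \<Longrightarrow> \<phi> i \<in> iso (G i) (H i)"
  shows "(\<lambda>x. \<lambda>i\<in>I. \<phi> i (x i)) \<in> iso (product_group I G) (product_group I H)"
proof -
  have hom: "\<phi> i \<in> hom (G i) (H i)" and bij: "bij_betw (\<phi> i) (carrier (G i)) (carrier (H i))"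
    if "i \<in> I" for i
    using \<phi>[OF that] by (simp_all add: iso_def)
  have "(\<lambda>x. \<lambda>i\<in>I. \<phi> i (x i)) \<in> hom (product_group I G) (product_group I H)"
  proof (rule homI)
    fix x y assume "x \<in> carrier (product_group I G)" "y \<in> carrier (product_group I G)"
    then show "(\<lambda>i\<in>I. \<phi> i ((x \<otimes>\<^bsub>product_group I G\<^esub> y) i)) =
        (\<lambda>i\<in>I. \<phi> i (x i)) \<otimes>\<^bsub>product_group I H\<^esub> (\<lambda>i\<in>I. \<phi> i (y i))"
      using hom by (auto simp: PiE_iff hom_def intro!: restrict_ext)
  next
    fix x assume "x \<in> carrier (product_group I G)"
    then show "(\<lambda>i\<in>I. \<phi> i (x i)) \<in> carrier (product_group I H)"
      by (auto simp: PiE_iff intro: hom_in_carrier[OF hom])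
  qed
  moreover have "bij_betw (\<lambda>x. \<lambda>i\<in>I. \<phi> i (x i)) (carrier (product_group I G)) (carrier (product_group I H))"
  proof (rule bij_betw_byWitness[where f' = "\<lambda>y. \<lambda>i\<in>I. inv_into (carrier (G i)) (\<phi> i) (y i)"])
    show "\<forall>x\<in>carrier (product_group I G).
        (\<lambda>i\<in>I. inv_into (carrier (G i)) (\<phi> i) ((\<lambda>i\<in>I. \<phi> i (x i)) i)) = x"
      by (auto simp: PiE_iff bij_betw_inv_into_left[OF bij] intro!: extensionalityI[of _ I])
    show "\<forall>y\<in>carrier (product_group I H).
        (\<lambda>i\<in>I. \<phi> i ((\<lambda>i\<in>I. inv_into (carrier (G i)) (\<phi> i) (y i)) i)) = y"
      by (auto simp: PiE_iff bij_betw_inv_into_right[OF bij] intro!: extensionalityI[of _ I])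
    show "(\<lambda>x. \<lambda>i\<in>I. \<phi> i (x i)) ` carrier (product_group I G) \<subseteq> carrier (product_group I H)"
      using hom_in_carrier[OF hom] by (auto simp: PiE_iff)
    show "(\<lambda>y. \<lambda>i\<in>I. inv_into (carrier (G i)) (\<phi> i) (y i)) ` carrier (product_group I H)
        \<subseteq> carrier (product_group I G)"
      using bij_betw_apply[OF bij_betw_inv_into[OF bij]] by (auto simp: PiE_iff)
  qed
  ultimately show ?thesis
    by (simp add: iso_def)
qed

lemma reindex_iso:
  assumes "inj_on c I"
  shows "(\<lambda>x. \<lambda>C\<in>c ` I. x (inv_into I c C)) \<in> iso (product_group I (\<lambda>_. G)) (product_group (c ` I) (\<lambda>_. G))"
proof -
  have inv: "inv_into I c (c i) = i" if "i \<in> I" for i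
    using assms that by simp
  have "bij_betw (\<lambda>x. \<lambda>C\<in>c ` I. x (inv_into I c C))
      (carrier (product_group I (\<lambda>_. G))) (carrier (product_group (c ` I) (\<lambda>_. G)))"
    by (rule bij_betw_byWitness[where f' = "\<lambda>y. \<lambda>i\<in>I. y (c i)"])
      (auto simp: PiE_iff inv intro!: extensionalityI[of _ I] extensionalityI[of _ "c ` I"])
  moreover have "(\<lambda>x. \<lambda>C\<in>c ` I. x (inv_into I c C)) \<in>
      hom (product_group I (\<lambda>_. G)) (product_group (c ` I) (\<lambda>_. G))"
    by (auto simp: hom_def PiE_iff inv intro!: restrict_ext)
  ultimately show ?thesis
    by (simp add: iso_def)
qed

lemma group_sym_powers: "group (sym_powers I J m)"
  by (simp add: sym_powers_def DirProd_group sym_group_is_group)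

section \<open>The automorphism group as a semidirect product\<close>

text \<open>
  A class \<open>C\<close> in \<open>T1\<close> or \<open>T2\<close> equals \<open>ops_with X\<close> for the set \<open>X\<close> of common neighbours of its
  elements, and the labeling over this \<open>X\<close> identifies it with \<open>{1..q}\<close>.
\<close>
lemma relabel_iso:
  fixes lab :: "'a::{field,finite} vertex set \<Rightarrow> nat \<Rightarrow> 'a vertex"
  assumes lab: "labeling lab"
  shows "relabel lab \<in> iso (sym_powers T1 T2 CARD('a)) twin_perms"
proof -
  have "perm_via (lab (\<Union>x\<in>C. sig_nbhd x)) CARD('a) C \<in> iso (sym_group CARD('a)) (BijGroup C)"
    if C: "C \<in> T1 \<union> T2" for C
  proof -
    obtain X where X: "X \<in> small_sets" "C = ops_with X"
      using C by (rule twin_class_cases)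
    then show ?thesis
      using perm_via_iso[OF labeling_bij[OF lab X(1)]] by (simp add: Union_sig_nbhd_ops_with)
  qed
  then show ?thesis
    unfolding relabel_def sym_powers_def twin_perms_def
    by (subst iso_paired2) (auto intro!: product_group_iso simp: sym_group_is_group group_BijGroup)
qed

lemma reindex_sym_powers_iso:
  assumes "inj_on c I" "inj_on d J"
  shows "reindex I J c d \<in> iso (sym_powers I J m) (sym_powers (c ` I) (d ` J) m)"
  using reindex_iso[OF assms(1)] reindex_iso[OF assms(2)]
  unfolding reindex_def sym_powers_def
  by (subst iso_paired2) (auto simp: sym_group_is_group)

text \<open>
  The split extension of automorphism groups with its kernel replaced by an isomorphic copy \<open>K\<close> and
  its quotient by the symmetric group on \<open>q + 1\<close> letters. The lift of a permutation \<open>\<tau>\<close> of the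
  letters restricts to the corresponding permutation of the points, so lifting followed by
  restriction is bijective, as the general result on split extensions requires.
\<close>
lemma semidirect_via_labeling:
  fixes lab :: "'a::{field,finite} vertex set \<Rightarrow> nat \<Rightarrow> 'a vertex"
    and K :: "('k, 'x) monoid_scheme"
  assumes lab: "labeling lab" and b: "bij_betw b {1..CARD('a) + 1} points"
    and K: "group K" and \<iota>: "\<iota> \<in> iso K twin_perms"
  shows "semidirect_via lab b K \<iota>"
proof -
  let ?S = "sym_group (CARD('a) + 1)"
  let ?s = "\<lambda>\<tau>. hat lab (perm_via b (CARD('a) + 1) points \<tau>)"
  have perm: "perm_via b (CARD('a) + 1) points \<in> iso ?S (BijGroup points)"
    using b by (rule perm_via_iso)
  then have "perm_via b (CARD('a) + 1) points \<in> hom ?S (BijGroup points)"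
    by (simp add: iso_def)
  from hom_compose[OF this hat_hom[OF lab]] have s: "?s \<in> hom ?S sig_aut"
    by (simp add: comp_def)
  have "perm_via b (CARD('a) + 1) points \<tau> \<in> Bij points" if "\<tau> \<in> carrier ?S" for \<tau>
    using perm that by (auto simp: iso_def hom_def)
  then have "bij_betw (point_restr \<circ> ?s) (carrier ?S) (carrier (BijGroup points))"
    using perm by (subst bij_betw_cong[of _ _ "perm_via b (CARD('a) + 1) points"])
      (simp_all add: point_restr_hat[OF lab] iso_def)
  moreover have "twin_incl \<circ> \<iota> \<in> mon K (sig_aut :: ('a vertex \<Rightarrow> 'a vertex) monoid)"
    using \<iota> twin_incl_mon by (intro mon_compose[of _ _ twin_perms]) (auto simp: iso_iff_mon_epi)
  moreover have "\<iota> ` carrier K = carrier twin_perms"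
    using \<iota> by (simp add: iso_def bij_betw_def)
  then have "(twin_incl \<circ> \<iota>) ` carrier K =
      kernel (sig_aut :: ('a vertex \<Rightarrow> 'a vertex) monoid) (BijGroup points) point_restr"
    by (simp only: image_comp[symmetric] twin_incl_kernel)
  moreover note K s group_sig_aut sym_group_is_group group_BijGroup point_restr_hom
  ultimately have split:
    "group K" "group (sig_aut :: ('a vertex \<Rightarrow> 'a vertex) monoid)" "group ?S"
    "group (BijGroup (points :: 'a vertex set))"
    "twin_incl \<circ> \<iota> \<in> mon K (sig_aut :: ('a vertex \<Rightarrow> 'a vertex) monoid)"
    "point_restr \<in> hom (sig_aut :: ('a vertex \<Rightarrow> 'a vertex) monoid) (BijGroup points)"
    "?s \<in> hom ?S sig_aut"
    "(twin_incl \<circ> \<iota>) ` carrier K =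
      kernel (sig_aut :: ('a vertex \<Rightarrow> 'a vertex) monoid) (BijGroup points) point_restr"
    "bij_betw (point_restr \<circ> ?s) (carrier ?S) (carrier (BijGroup points))"
    by blast+
  show ?thesis
    unfolding semidirect_via_def theta_def Let_def
    using \<iota> conj_action_in_hom_AutoGroup[OF split] semidirect_iso[OF split] conj_action_eq[OF split]
    by (simp add: comp_def)
qed

theorem theorem3p19:
  fixes q :: nat
  assumes q: "q = CARD('a::{field,finite})"
  shows
    "card (T1 :: 'a vertex set set) = q + 1 \<and>
     card (T2 :: 'a vertex set set) = q * (q + 1) div 2 \<and>
     short_exact twin_perms (sig_aut :: ('a vertex \<Rightarrow> 'a vertex) monoid) (BijGroup points)
       twin_incl point_restr \<and>
     splits (sig_aut :: ('a vertex \<Rightarrow> 'a vertex) monoid) (BijGroup points) point_restr \<and>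
     card (points :: 'a vertex set) = q + 1 \<and>
     (\<forall>X \<subseteq> (points :: 'a vertex set). 1 \<le> card X \<and> card X \<le> 2 \<longrightarrow> card (ops_with X) = q) \<and>
     (\<forall>lab :: 'a vertex set \<Rightarrow> nat \<Rightarrow> 'a vertex. labeling lab \<longrightarrow>
        (\<forall>\<sigma> \<in> carrier (BijGroup points).
           hat lab \<sigma> \<in> carrier sig_aut \<and> point_restr (hat lab \<sigma>) = \<sigma>) \<and>
        (\<forall>b. bij_betw b {1..q + 1} points \<longrightarrow>
           semidirect_via lab b (sym_powers T1 T2 q) (relabel lab) \<and>
           (\<forall>c d. bij_betw c {1..q + 1} T1 \<and> bij_betw d {1..q * (q + 1) div 2} T2 \<longrightarrow>
              semidirect_via lab b (sym_powers {1..q + 1} {1..q * (q + 1) div 2} q)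
                (relabel lab \<circ> reindex {1..q + 1} {1..q * (q + 1) div 2} c d))))"
proof (intro conjI allI ballI impI)
  show "card (T1 :: 'a vertex set set) = q + 1"
    using card_op_twin_classes[of 1, where 'a = 'a] by (simp add: q)
  show "card (T2 :: 'a vertex set set) = q * (q + 1) div 2"
    using card_op_twin_classes[of 2, where 'a = 'a] by (simp add: q choose_two mult.commute)
  show "short_exact twin_perms (sig_aut :: ('a vertex \<Rightarrow> 'a vertex) monoid) (BijGroup points)
      twin_incl point_restr"
    by (rule sig_short_exact)
  show "splits (sig_aut :: ('a vertex \<Rightarrow> 'a vertex) monoid) (BijGroup points) point_restr"
    by (rule sig_splits)
  show "card (points :: 'a vertex set) = q + 1"
    by (simp add: q card_points)
  show "card (ops_with X) = q" if "X \<subseteq> points" "1 \<le> card X \<and> card X \<le> 2" for X :: "'a vertex set"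
    using that card_ops_with[of X] by (simp add: q)
next
  fix lab :: "'a vertex set \<Rightarrow> nat \<Rightarrow> 'a vertex" assume lab: "labeling lab"
  show "hat lab \<sigma> \<in> carrier sig_aut" "point_restr (hat lab \<sigma>) = \<sigma>"
    if "\<sigma> \<in> carrier (BijGroup points)" for \<sigma>
    using that by (simp_all add: hat_aut[OF lab] point_restr_hat[OF lab])
  fix b :: "nat \<Rightarrow> 'a vertex" assume b: "bij_betw b {1..q + 1} points"
  have relabel: "relabel lab \<in> iso (sym_powers T1 T2 q) twin_perms"
    unfolding q using lab by (rule relabel_iso)
  then show "semidirect_via lab b (sym_powers T1 T2 q) (relabel lab)"
    using lab b by (intro semidirect_via_labeling) (simp_all add: q group_sym_powers)
  fix c d
  let ?n1 = "{1..q + 1}" and ?n2 = "{1..q * (q + 1) div 2}"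
  assume "bij_betw c ?n1 (T1 :: 'a vertex set set) \<and> bij_betw d ?n2 (T2 :: 'a vertex set set)"
  then have "reindex ?n1 ?n2 c d \<in> iso (sym_powers ?n1 ?n2 q) (sym_powers T1 T2 q)"
    using reindex_sym_powers_iso[of c ?n1 d ?n2 q] by (simp add: bij_betw_def)
  then have "relabel lab \<circ> reindex ?n1 ?n2 c d \<in> iso (sym_powers ?n1 ?n2 q) twin_perms"
    using relabel by (rule iso_set_trans)
  then show "semidirect_via lab b (sym_powers ?n1 ?n2 q) (relabel lab \<circ> reindex ?n1 ?n2 c d)"
    using lab b by (intro semidirect_via_labeling) (simp_all add: q group_sym_powers)
qed

end
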